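(* Let $A\in\mathbb R^{n\times n}$, let $\lambda_0$ be a simple eigenvalue of $A$, and let $\widetilde\varepsilon_0>0$ be as in the context. Given $\varepsilon\in(0,\widetilde\varepsilon_0]$, consider the differential system $$\dot E=-\widetilde P_E(\mathrm{Re}(S))+\langle E,\mathrm{Re}(S)\rangle\,E,\qquad E\in\mathcal R_1\cap\mathcal M_4,\qquad( * )$$ where $S=S(E)$ and the orthogonal projection $\widetilde P_E$ onto $T_E\mathcal M_4$ are defined in the context. Then the right-hand side of $( * )$ is antiparallel to the projection onto $\mathcal T_E\mathcal R_1\cap\mathcal T_E\mathcal M_4$ of the gradient of $|y^Hx|$ (as a function of $E$). More precisely, along solutions of $( * )$, $$\frac{\mathrm d}{\mathrm dt}|y^Hx|=-\varepsilon\,|y^Hx|\,\|\widetilde P_E(\mathrm{Re}(S))-\langle E,\mathrm{Re}(S)\rangle E\|_F^2 .$$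
   Context: $\langle A,B\rangle=\mathrm{trace}(A^HB)$ and $\|A\|_F=\sqrt{\langle A,A\rangle}$. $\mathcal R_1=\{E\in\mathbb R^{n\times n}:\|E\|_F=1\}$. $\mathrm{Re}(S)$ is the entrywise real part. $A$ is real, $\lambda_0$ is a simple (possibly non-real) eigenvalue of $A$, and $\widetilde\varepsilon_0>0$ is fixed (it exists by continuity) such that for every $\varepsilon\in[0,\widetilde\varepsilon_0]$ and $E\in\mathcal R_1$ the matrix $A+\varepsilon E$ has a simple eigenvalue $\lambda=\lambda(\varepsilon,E)$ close to $\lambda_0$ (the continuous continuation of $\lambda_0$, with $\lambda(0,E)=\lambda_0$). $x$ and $y$ are (complex) right and left eigenvectors of $A+\varepsilon E$ associated to $\lambda$, i.e. $(A+\varepsilon E)x=\lambda x$, $y^H(A+\varepsilon E)=\lambda y^H$, with $\|x\|_2=\|y\|_2=1$. For a singular matrix $M$ with a simple zero eigenvalue, its group inverse is the unique $G$ with $MG=GM$, $GMG=G$, $MGM=M$. $G$ denotes the group inverse of $A+\varepsilon E-\lambda I$, and $S=yy^HG^H+G^Hxx^H$. $\mathcal M_4$ is the manifold of matrices in $\mathbb R^{n\times n}$ of rank exactly $4$. Each $E\in\mathcal M_4$ can be written $E=UTV^{\mathrm T}$ with $U,V\in\mathbb R^{n\times4}$ having orthonormal columns and $T\in\mathbb R^{4\times4}$ nonsingular; the orthogonal projection of $Z\in\mathbb R^{n\times n}$ onto $T_E\mathcal M_4$ is $\widetilde P_E(Z)=Z-(I-UU^{\mathrm T})Z(I-VV^{\mathrm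 T})$. *)

theory Defs
  imports "HOL-Analysis.Analysis" "HOL-Computational_Algebra.Polynomial"
begin

text \<open>
  An \<open>m \<times> n\<close> matrix is an element of \<open>'a ^ 'n ^ 'm\<close>. On real matrices, the library's \<open>inner\<close> and
  \<open>norm\<close> are the Frobenius inner product and the Frobenius norm; on complex vectors, \<open>norm\<close> is the
  2-norm.
\<close>

lemma inner_eq_trace_transpose_mult:
  fixes A B :: "real^'n^'m"
  shows "A \<bullet> B = trace (transpose A ** B)"
  unfolding inner_vec_def trace_def transpose_def matrix_matrix_mult_def
  by (simp, rule sum.swap)

definition complexify :: "real^'n^'m \<Rightarrow> complex^'n^'m" where
  "complexify A = map_matrix complex_of_real A"

definition Re_matrix :: "complex^'n^'m \<Rightarrow> real^'n^'m" where
  "Re_matrix S = map_matrix Re S"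

definition hermitian_transpose :: "complex^'n^'m \<Rightarrow> complex^'m^'n" where
  "hermitian_transpose M = transpose (map_matrix cnj M)"

definition cnj_vec :: "complex^'n \<Rightarrow> complex^'n" where
  "cnj_vec y = (\<chi> i. cnj (y $ i))"

text \<open>The scalar \<open>y\<^sup>H x\<close>, conjugate-linear in the first argument.\<close>

definition hprod :: "complex^'n \<Rightarrow> complex^'n \<Rightarrow> complex" where
  "hprod y x = (\<Sum>i\<in>UNIV. cnj (y $ i) * x $ i)"

text \<open>The rank-one matrix \<open>x x\<^sup>H\<close>.\<close>

definition self_outer :: "complex^'n \<Rightarrow> complex^'n^'n" where
  "self_outer x = (\<chi> i j. x $ i * cnj (x $ j))"

definition charpoly :: "complex^'n^'n \<Rightarrow> complex poly" where
  "charpoly M = det (mat [:0, 1:] - map_matrix (\<lambda>c. [:c:]) M)"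

definition simple_eigenvalue :: "complex^'n^'n \<Rightarrow> complex \<Rightarrow> bool" where
  "simple_eigenvalue M \<mu> \<longleftrightarrow> order \<mu> (charpoly M) = 1"

text \<open>\<open>cnj_vec y v* M\<close> is the row vector \<open>y\<^sup>H M\<close>.\<close>

definition unit_eigenvectors ::
  "complex^'n^'n \<Rightarrow> complex \<Rightarrow> complex^'n \<Rightarrow> complex^'n \<Rightarrow> bool" where
  "unit_eigenvectors M \<mu> x y \<longleftrightarrow>
     M *v x = \<mu> *s x \<and> cnj_vec y v* M = \<mu> *s cnj_vec y \<and> norm x = 1 \<and> norm y = 1"

text \<open>The equations determine \<open>G\<close> uniquely; it exists if \<open>0\<close> is a simple eigenvalue of \<open>M\<close>.\<close>

definition group_inverse :: "complex^'n^'n \<Rightarrow> complex^'n^'n" where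
  "group_inverse M = (THE G. M ** G = G ** M \<and> G ** M ** G = G \<and> M ** G ** M = M)"

definition S_matrix ::
  "complex^'n^'n \<Rightarrow> complex \<Rightarrow> complex^'n \<Rightarrow> complex^'n \<Rightarrow> complex^'n^'n" where
  "S_matrix M \<mu> x y =
     self_outer y ** hermitian_transpose (group_inverse (M - mat \<mu>)) +
     hermitian_transpose (group_inverse (M - mat \<mu>)) ** self_outer x"

definition R1 :: "(real^'n^'n) set" where
  "R1 = {E. norm E = 1}"

definition M4 :: "(real^'n^'n) set" where
  "M4 = {E. rank E = 4}"

text \<open>
  Velocities at \<open>p\<close> of curves in \<open>M\<close> through \<open>p\<close>. This is the usual tangent space when \<open>M\<close> is a smooth
  embedded submanifold, as \<open>R1\<close> and \<open>M4\<close> are.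
\<close>

definition tangent_space :: "'a::real_normed_vector set \<Rightarrow> 'a \<Rightarrow> 'a set" where
  "tangent_space M p =
     {v. \<exists>\<gamma> \<delta>. \<delta> > 0 \<and> \<gamma> 0 = p \<and> (\<forall>t\<in>{-\<delta><..<\<delta>}. \<gamma> t \<in> M) \<and>
         (\<gamma> has_vector_derivative v) (at 0)}"

definition is_orth_proj :: "'a::real_inner set \<Rightarrow> 'a \<Rightarrow> 'a \<Rightarrow> bool" where
  "is_orth_proj W z p \<longleftrightarrow> p \<in> W \<and> (\<forall>w\<in>W. (z - p) \<bullet> w = 0)"

definition M4_factors :: "real^'n^'n \<Rightarrow> real^4^'n \<Rightarrow> real^4^'n \<Rightarrow> bool" where
  "M4_factors E U V \<longleftrightarrow>
     transpose U ** U = mat 1 \<and> transpose V ** V = mat 1 \<and>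
     (\<exists>T :: real^4^4. invertible T \<and> E = U ** T ** transpose V)"

definition M4_proj :: "real^4^'n \<Rightarrow> real^4^'n \<Rightarrow> real^'n^'n \<Rightarrow> real^'n^'n" where
  "M4_proj U V Z = Z - (mat 1 - U ** transpose U) ** Z ** (mat 1 - V ** transpose V)"

text \<open>
  In what follows \<open>\<mu>\<close>, \<open>x\<close>, \<open>y\<close> assign to each \<open>E\<close> an eigenvalue of \<open>A + \<epsilon> E\<close> and corresponding unit
  right and left eigenvectors, and \<open>U\<close>, \<open>V\<close> assign to each \<open>E\<close> the orthonormal factors of \<open>E\<close>. No
  regularity is required of \<open>x\<close>, \<open>y\<close>, \<open>U\<close>, \<open>V\<close>: \<open>ReS\<close>, \<open>\<bar>y\<^sup>H x\<bar>\<close> and \<open>M4_proj\<close> do not depend on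
  their choice.
\<close>

definition eigendata_on ::
  "(real^'n^'n) set \<Rightarrow> real^'n^'n \<Rightarrow> real \<Rightarrow> (real^'n^'n \<Rightarrow> complex) \<Rightarrow>
   (real^'n^'n \<Rightarrow> complex^'n) \<Rightarrow> (real^'n^'n \<Rightarrow> complex^'n) \<Rightarrow> bool" where
  "eigendata_on D A \<epsilon> \<mu> x y \<longleftrightarrow>
     (\<forall>E\<in>D. simple_eigenvalue (complexify (A + \<epsilon> *\<^sub>R E)) (\<mu> E) \<and>
             unit_eigenvectors (complexify (A + \<epsilon> *\<^sub>R E)) (\<mu> E) (x E) (y E))"

definition ReS ::
  "real^'n^'n \<Rightarrow> real \<Rightarrow> (real^'n^'n \<Rightarrow> complex) \<Rightarrow> (real^'n^'n \<Rightarrow> complex^'n) \<Rightarrow>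
   (real^'n^'n \<Rightarrow> complex^'n) \<Rightarrow> real^'n^'n \<Rightarrow> real^'n^'n" where
  "ReS A \<epsilon> \<mu> x y E = Re_matrix (S_matrix (complexify (A + \<epsilon> *\<^sub>R E)) (\<mu> E) (x E) (y E))"

definition flow_rhs ::
  "real^'n^'n \<Rightarrow> real \<Rightarrow> (real^'n^'n \<Rightarrow> complex) \<Rightarrow> (real^'n^'n \<Rightarrow> complex^'n) \<Rightarrow>
   (real^'n^'n \<Rightarrow> complex^'n) \<Rightarrow> (real^'n^'n \<Rightarrow> real^4^'n) \<Rightarrow> (real^'n^'n \<Rightarrow> real^4^'n) \<Rightarrow>
   real^'n^'n \<Rightarrow> real^'n^'n" where
  "flow_rhs A \<epsilon> \<mu> x y U V E =
     - M4_proj (U E) (V E) (ReS A \<epsilon> \<mu> x y E) + (E \<bullet> ReS A \<epsilon> \<mu> x y E) *\<^sub>R E"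

text \<open>
  The eigenvalue and the eigenvectors are given for \<open>E\<close> in \<open>R1\<close> only, whereas the (Euclidean) gradient
  of \<open>\<bar>y\<^sup>H x\<bar>\<close> at \<open>E\<close> needs them on a neighbourhood \<open>W\<close> of \<open>E\<close> in the space of all matrices. There
  they are extended with the eigenvalue depending continuously on the matrix, which determines the
  germ of \<open>\<bar>y\<^sup>H x\<bar>\<close> at \<open>E\<close>.
\<close>

definition local_extension ::
  "real^'n^'n \<Rightarrow> real \<Rightarrow> (real^'n^'n \<Rightarrow> complex) \<Rightarrow> (real^'n^'n \<Rightarrow> complex^'n) \<Rightarrow>
   (real^'n^'n \<Rightarrow> complex^'n) \<Rightarrow> real^'n^'n \<Rightarrow> (real^'n^'n) set \<Rightarrow>
   (real^'n^'n \<Rightarrow> complex) \<Rightarrow> (real^'n^'n \<Rightarrow> complex^'n) \<Rightarrow> (real^'n^'n \<Rightarrow> complex^'n) \<Rightarrow>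
   bool" where
  "local_extension A \<epsilon> \<mu> x y E W \<mu>' x' y' \<longleftrightarrow>
     open W \<and> E \<in> W \<and> continuous_on W \<mu>' \<and> eigendata_on W A \<epsilon> \<mu>' x' y' \<and>
     (\<forall>F\<in>W \<inter> R1. \<mu>' F = \<mu> F \<and> x' F = x F \<and> y' F = y F)"

definition eigenvalue_continuation ::
  "real^'n^'n \<Rightarrow> complex \<Rightarrow> real \<Rightarrow> (real \<Rightarrow> real^'n^'n \<Rightarrow> complex) \<Rightarrow> bool" where
  "eigenvalue_continuation A lam0 \<epsilon>0 lam \<longleftrightarrow>
     continuous_on ({0..\<epsilon>0} \<times> R1) (\<lambda>(\<epsilon>, E). lam \<epsilon> E) \<and>
     (\<forall>E\<in>R1. lam 0 E = lam0) \<and>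
     (\<forall>\<epsilon>\<in>{0..\<epsilon>0}. \<forall>E\<in>R1. simple_eigenvalue (complexify (A + \<epsilon> *\<^sub>R E)) (lam \<epsilon> E))"

end

theory Submission
  imports Defs
begin

text \<open>
  Let \<open>M\<close> be the perturbed matrix \<open>A + \<epsilon> E\<close> with simple eigenvalue \<open>\<lambda>\<close>, eigenvectors \<open>x\<close>, \<open>y\<close>, and let
  \<open>G\<close> be the group inverse of \<open>M - \<lambda> I\<close>. The core of the proof is that the gradient of \<open>|y\<^sup>H x|\<close> is
  \<open>\<epsilon> |y\<^sup>H x| Re S\<close>. The unit eigenvectors need not be continuous, but rescaled so that their
  product with the opposite eigenvector at \<open>E\<close> is constant they are differentiable: a perturbation \<open>H\<close> of
  \<open>M\<close> moves the right one by \<open>- G H x\<close> and the left one by \<open>- (y\<^sup>H H G)\<^sup>H\<close> to first order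
  (\<open>normalized_eigenvector_derivative\<close>). The product of the rescaled eigenvectors is stationary, because
  \<open>G x = 0\<close> and \<open>y\<^sup>H G = 0\<close>, and the change of their norms is what \<open>S\<close> represents
  (\<open>gradient_eigenvector_product\<close>).

  This needs two facts on simple eigenvalues. First, simplicity as a root of the characteristic
  polynomial excludes a second kernel vector and a Jordan chain (\<open>simple_eigenvalue_kernel\<close>), which
  gives \<open>y\<^sup>H x \<noteq> 0\<close> and a group inverse with \<open>G (M - \<lambda> I) = I - x y\<^sup>H / (y\<^sup>H x)\<close>
  (\<open>eigenvectors_nonorthogonal_and_group_inverse\<close>). Second, a simple root of a polynomial with a continuous
  parameter continues to a unique nearby root, which is continuous and simple
  (\<open>simple_root_continuation\<close>). So the eigenvalue given on the unit sphere extends to an open set of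
  matrices, as required for a gradient (\<open>local_extension_exists\<close>).

  The tangent space of the sphere at \<open>E\<close> is the complement of \<open>E\<close>, and that of the rank-4 manifold
  is the range of the projection \<open>M4_proj\<close> (\<open>M4_proj_in_tangent_space\<close>, \<open>tangent_space_M4_subset\<close>). As
  \<open>E\<close> itself lies in this range, \<open>M4_proj Z - \<langle>E, Z\<rangle> E\<close> is the orthogonal projection of \<open>Z\<close> onto the
  intersection (\<open>orth_proj_R1_M4\<close>). With \<open>Z = Re S\<close> this is minus the right-hand side of the flow, so
  the latter is antiparallel to the projected gradient with factor \<open>1 / (\<epsilon> |y\<^sup>H x|)\<close>. Along a
  solution the chain rule gives the inner product of the gradient with the velocity \<open>- q\<close>, where \<open>q\<close> is
  that projection of \<open>Re S\<close>, and \<open>\<langle>Re S, q\<rangle> = \<parallel>q\<parallel>\<^sup>2\<close>.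
\<close>

section \<open>Simple eigenvalues and the group inverse\<close>

lemma poly_det:
  fixes P :: "'a::comm_ring_1 poly^'n^'n"
  shows "poly (det P) z = det (map_matrix (\<lambda>p. poly p z) P)"
  unfolding det_def poly_sum poly_mult poly_prod
  by (intro sum.cong refl arg_cong2[where f="(*)"]) (auto simp: sign_def)

lemma poly_charpoly: "poly (charpoly M) z = det (mat z - M)"
proof -
  have "map_matrix (\<lambda>p. poly p z) (mat [:0, 1:] - map_matrix (\<lambda>c. [:c:]) M) = mat z - M"
    by (simp add: vec_eq_iff mat_def)
  then show ?thesis
    by (simp add: charpoly_def poly_det)
qed

lemma mat_mult_vec: "mat z *v v = z *s (v :: 'a::comm_semiring_1^'n)"
  by (simp add: matrix_vector_mult_def mat_def vec_eq_iff if_distrib if_distribR cong: if_cong)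

lemma vec_mult_diff_mat:
  "v v* (M - mat z) = v v* M - z *s (v :: 'a::comm_ring_1^'n)"
proof -
  have "transpose (M - mat z) = transpose M - mat z"
    by (simp add: vec_eq_iff transpose_def mat_def)
  then show ?thesis
    by (metis transpose_matrix_vector matrix_vector_mult_diff_rdistrib mat_mult_vec)
qed

text \<open>
  The order of a root is meaningful for nonzero polynomials only. A number exceeding the operator
  norm of \<open>M\<close> is not an eigenvalue, so it is not a root.
\<close>

lemma charpoly_nonzero: "charpoly (M :: complex^'n^'n) \<noteq> 0"
proof
  assume "charpoly M = 0"
  define z where "z = complex_of_real (onorm ((*v) M) + 1)"
  have pos: "onorm ((*v) M) \<ge> 0"
    by (intro onorm_pos_le) simp
  have "det (mat z - M) = 0"
    using \<open>charpoly M = 0\<close> by (metis poly_charpoly poly_0)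
  then obtain v where v: "v \<noteq> 0" "(mat z - M) *v v = 0"
    using invertible_det_nz invertible_left_inverse matrix_left_invertible_ker by metis
  have "M *v v = z *s v"
    using v(2) by (simp add: matrix_vector_mult_diff_rdistrib mat_mult_vec)
  then have "cmod z * norm v = norm (M *v v)"
    by (simp add: norm_vec_def L2_set_right_distrib norm_mult)
  also have "\<dots> \<le> onorm ((*v) M) * norm v"
    by (intro onorm) simp
  finally have "cmod z \<le> onorm ((*v) M)"
    using v(1) by simp
  moreover have "cmod z = onorm ((*v) M) + 1"
    using pos unfolding z_def norm_of_real by simp
  ultimately show False by simp
qed

lemma charpoly_transpose: "charpoly (transpose M) = charpoly M"
proof -
  have "mat [:0, 1:] - map_matrix (\<lambda>c. [:c:]) (transpose M) =
      transpose (mat [:0, 1:] - map_matrix (\<lambda>c. [:c:]) M)"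
    by (simp add: vec_eq_iff transpose_def mat_def)
  then show ?thesis
    by (simp add: charpoly_def)
qed

lemma simple_eigenvalue_iff:
  "simple_eigenvalue M \<mu> \<longleftrightarrow>
     poly (charpoly M) \<mu> = 0 \<and> poly (pderiv (charpoly M)) \<mu> \<noteq> 0"
proof -
  have nz: "charpoly M \<noteq> 0" by (rule charpoly_nonzero)
  show ?thesis
  proof (cases "poly (charpoly M) \<mu> = 0")
    case True
    then have o: "order \<mu> (charpoly M) \<noteq> 0"
      using nz order_root by blast
    have p: "pderiv (charpoly M) \<noteq> 0"
      using True nz by (metis pderiv_iszero poly_pCons poly_0 mult_zero_right add_0_right pCons_0_0)
    have "order \<mu> (charpoly M) = Suc (order \<mu> (pderiv (charpoly M)))"
      using order_pderiv nz True by metis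
    then show ?thesis
      using True p by (simp add: simple_eigenvalue_def order_root)
  next
    case False
    then show ?thesis
      by (simp add: simple_eigenvalue_def order_root)
  qed
qed

lemma exists_eigenvector:
  fixes M :: "complex^'n^'n"
  assumes "poly (charpoly M) \<mu> = 0"
  obtains x where "norm x = 1" "M *v x = \<mu> *s x"
proof -
  have "det (mat \<mu> - M) = 0"
    using assms by (simp add: poly_charpoly)
  then obtain v where v: "v \<noteq> 0" "(mat \<mu> - M) *v v = 0"
    using invertible_det_nz invertible_left_inverse matrix_left_invertible_ker by metis
  define x where "x = complex_of_real (inverse (norm v)) *s v"
  have "M *v v = \<mu> *s v"
    using v(2) by (simp add: matrix_vector_mult_diff_rdistrib mat_mult_vec)
  then have "M *v x = \<mu> *s x"
    unfolding x_def by (metis vector_smult_assoc vec.scale mult.commute)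
  moreover have "norm x = 1"
    using v(1) by (simp add: x_def norm_vec_def norm_mult norm_inverse L2_set_eq_0_iff vec_eq_iff
        flip: L2_set_right_distrib)
  ultimately show thesis
    using that by blast
qed

text \<open>
  A simple eigenvalue has a one-dimensional kernel (the case \<open>c = 0\<close>) and no Jordan chain of length two
  (the case \<open>c = 1\<close>). Otherwise, subtract a multiple of \<open>x\<close> from \<open>z\<close> to get a vector \<open>w\<close> that vanishes
  at a position \<open>i\<close> where \<open>x\<close> does not, and choose \<open>j\<close> with \<open>w\<^sub>j \<noteq> 0\<close>. By Cramer's rule, \<open>t I - M\<close> and
  the matrix \<open>P\<close> obtained from it by putting \<open>x\<close> in column \<open>i\<close> and \<open>w\<close> in column \<open>j\<close> satisfy
  \<open>x\<^sub>i w\<^sub>j det (t I - M) = (t - \<mu>)\<^sup>2 det P\<close>, so that \<open>\<mu>\<close> is a root of order at least two.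
\<close>

lemma simple_eigenvalue_kernel:
  fixes M :: "complex^'n^'n"
  assumes simple: "simple_eigenvalue M \<mu>"
    and x: "x \<noteq> 0" "(M - mat \<mu>) *v x = 0"
    and z: "(M - mat \<mu>) *v z = c *s x"
  obtains a where "z = a *s x"
proof (rule ccontr)
  assume "\<not> thesis"
  then have indep: "z \<noteq> a *s x" for a
    using that by blast
  obtain i where i: "x $ i \<noteq> 0"
    using x(1) by (auto simp: vec_eq_iff)
  define w where "w = z - (z $ i / x $ i) *s x"
  have wi: "w $ i = 0"
    using i by (simp add: w_def)
  have "w \<noteq> 0"
    using indep[of "z $ i / x $ i"] by (simp add: w_def)
  then obtain j where j: "w $ j \<noteq> 0"
    by (auto simp: vec_eq_iff)
  then have ij: "j \<noteq> i" using wi by auto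
  have Mx: "M *v x = \<mu> *s x" and Mw: "M *v w = \<mu> *s w + c *s x"
    using x(2) z
    by (auto simp: w_def matrix_vector_mult_diff_rdistrib matrix_vector_mult_diff_distrib
        mat_mult_vec vec.scale vec_eq_iff algebra_simps)
  define P :: "complex poly^'n^'n" where
    "P = (\<chi> r k. if k = j then [:w $ r:] else if k = i then [:x $ r:]
                 else (mat [:0, 1:] - map_matrix (\<lambda>c. [:c:]) M) $ r $ k)"
  have eq: "(t - \<mu>)\<^sup>2 * poly (det P) t = x $ i * w $ j * poly (charpoly M) t" if t: "t \<noteq> \<mu>" for t
  proof -
    let ?A = "mat t - M"
    let ?A1 = "\<chi> r k. if k = i then (?A *v ((1 / (t - \<mu>)) *s x)) $ r else ?A $ r $ k"
    have Ax: "?A *v ((1 / (t - \<mu>)) *s x) = x"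
      using t by (simp add: matrix_vector_mult_diff_rdistrib mat_mult_vec Mx vec.scale vec_eq_iff
          flip: left_diff_distrib diff_divide_distrib)
    have det1: "det ?A1 = x $ i / (t - \<mu>) * det ?A"
      unfolding cramer_lemma by simp
    \<comment> \<open>Column \<open>i\<close> of \<open>?A1\<close> is \<open>x\<close>, so the summand \<open>axis i c\<close> cancels the term \<open>- c x\<close> in \<open>?A w\<close>,
      leaving \<open>?A1 ?u = w\<close>.\<close>
    let ?u = "(1 / (t - \<mu>)) *s (w + axis i c)"
    have col: "?A1 *v v = ?A *v (v - axis i (v $ i)) + v $ i *s x" for v
    proof -
      have "(?A1 *v v) $ r = (?A *v (v - axis i (v $ i)) + v $ i *s x) $ r" for r
      proof -
        have "(?A1 *v v) $ r = ?A1 $ r $ i * v $ i + (\<Sum>k\<in>UNIV - {i}. ?A1 $ r $ k * v $ k)"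
          unfolding matrix_vector_mult_def by (simp add: sum.remove[of UNIV i])
        also have "?A1 $ r $ i = x $ r"
          using Ax by simp
        also have "(\<Sum>k\<in>UNIV - {i}. ?A1 $ r $ k * v $ k) =
            (\<Sum>k\<in>UNIV - {i}. ?A $ r $ k * (v - axis i (v $ i)) $ k)"
          by (intro sum.cong) (auto simp: axis_def)
        also have "\<dots> = (?A *v (v - axis i (v $ i))) $ r"
          unfolding matrix_vector_mult_def by (simp add: sum.remove[of UNIV i] axis_def)
        finally show ?thesis by simp
      qed
      then show ?thesis by (simp add: vec_eq_iff)
    qed
    have e1: "?u - axis i (?u $ i) = (1 / (t - \<mu>)) *s w"
      using wi by (auto simp: vec_eq_iff axis_def)
    have e2: "?A *v ((1 / (t - \<mu>)) *s w) = w - (c / (t - \<mu>)) *s x"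
    proof -
      have "?A *v w = (t - \<mu>) *s w - c *s x"
        by (simp add: matrix_vector_mult_diff_rdistrib mat_mult_vec Mw vec_eq_iff algebra_simps)
      then show ?thesis
        using t by (simp add: vec.scale vec_eq_iff diff_divide_distrib flip: left_diff_distrib)
    qed
    have e3: "?u $ i = c / (t - \<mu>)"
      using wi by (simp add: axis_def)
    have "?A1 *v ?u = ?A *v (?u - axis i (?u $ i)) + ?u $ i *s x"
      by (rule col)
    also have "\<dots> = w"
      unfolding e1 unfolding e2 e3 by simp
    finally have A1u: "?A1 *v ?u = w" .
    have "map_matrix (\<lambda>p. poly p t) P =
        (\<chi> r k. if k = j then (?A1 *v ?u) $ r else ?A1 $ r $ k)"
      unfolding A1u unfolding Ax by (simp add: vec_eq_iff P_def mat_def)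
    then have "poly (det P) t = det (\<chi> r k. if k = j then (?A1 *v ?u) $ r else ?A1 $ r $ k)"
      by (simp add: poly_det)
    also have "\<dots> = ?u $ j * det ?A1"
      by (rule cramer_lemma)
    also have "\<dots> = w $ j / (t - \<mu>) * (x $ i / (t - \<mu>) * det ?A)"
      unfolding det1 using ij by (simp add: axis_def)
    finally have *: "poly (det P) t = w $ j / (t - \<mu>) * (x $ i / (t - \<mu>) * det ?A)" .
    have "D\<^sup>2 * (a / D * (b / D * e)) = b * a * e" if "D \<noteq> 0" for D a b e :: complex
      using that by (simp add: power2_eq_square)
    then show ?thesis
      using t unfolding * poly_charpoly by simp
  qed
  have root: "poly (charpoly M) \<mu> = 0"
    using simple by (simp add: simple_eigenvalue_iff)
  have "[:- \<mu>, 1:]\<^sup>2 * det P = smult (x $ i * w $ j) (charpoly M)"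
  proof -
    have "poly ([:- \<mu>, 1:]\<^sup>2 * det P) t = poly (smult (x $ i * w $ j) (charpoly M)) t" for t
      using eq[of t] root by (cases "t = \<mu>") (simp_all add: power2_eq_square algebra_simps)
    then show ?thesis
      by (simp add: poly_eq_poly_eq_iff[symmetric] fun_eq_iff)
  qed
  then have "[:- \<mu>, 1:]\<^sup>2 dvd charpoly M"
    using i j by (metis dvd_triv_left dvd_smult_cancel no_zero_divisors)
  then have "2 \<le> order \<mu> (charpoly M)"
    using charpoly_nonzero order_divides by blast
  then show False
    using simple by (simp add: simple_eigenvalue_def)
qed


lemma hprod_alt: "hprod y x = (\<Sum>i\<in>UNIV. cnj_vec y $ i * x $ i)"
  by (simp add: hprod_def cnj_vec_def)

lemma hprod_linear:
  "hprod y (u + v) = hprod y u + hprod y v" "hprod y (u - v) = hprod y u - hprod y v"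
  "hprod y (c *s v) = c * hprod y v" "hprod y 0 = 0"
  by (simp_all add: hprod_def sum.distrib sum_subtractf sum_distrib_left algebra_simps)

lemma hprod_self: "hprod x x = (complex_of_real (norm x))\<^sup>2"
proof -
  have "hprod x x = (\<Sum>i\<in>UNIV. complex_of_real ((cmod (x $ i))\<^sup>2))"
    unfolding hprod_def by (intro sum.cong refl) (simp add: complex_norm_square mult.commute flip: of_real_power)
  also have "\<dots> = (complex_of_real (norm x))\<^sup>2"
    by (simp add: norm_vec_def L2_set_def sum_nonneg flip: of_real_power)
  finally show ?thesis .
qed

lemma norm_smult: "norm (c *s v) = cmod c * norm v" for v :: "complex^'n"
  by (simp add: norm_vec_def norm_mult L2_set_right_distrib)

lemma hprod_matrix: "hprod y (M *v v) = (\<Sum>i\<in>UNIV. (cnj_vec y v* M) $ i * v $ i)"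
  unfolding hprod_alt matrix_vector_mult_def vector_matrix_mult_def
  by (simp add: sum_distrib_left sum_distrib_right, subst sum.swap)
     (simp add: mult_ac)

text \<open>
  The spectral projection \<open>x y\<^sup>H / (y\<^sup>H x)\<close> of an eigenvalue with right and left eigenvectors \<open>x\<close> and \<open>y\<close>.
\<close>

definition eigenprojection :: "complex^'n \<Rightarrow> complex^'n \<Rightarrow> complex^'n^'n" where
  "eigenprojection x y = (\<chi> i j. x $ i * cnj (y $ j) / hprod y x)"

lemma eigenprojection_mult: "eigenprojection x y *v v = (hprod y v / hprod y x) *s x"
  by (simp add: eigenprojection_def matrix_vector_mult_def hprod_def vec_eq_iff
      sum_divide_distrib sum_distrib_left sum_distrib_right mult_ac)

lemma self_outer_mult: "self_outer x *v v = hprod x v *s x"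
  by (simp add: self_outer_def matrix_vector_mult_def hprod_def vec_eq_iff
      sum_distrib_left sum_distrib_right mult_ac)

lemma matrix_add_rdistrib: "(B + C) ** A = B ** A + C ** (A :: 'a::semiring_1^'n^'m)"
  by (simp add: matrix_matrix_mult_def vec_eq_iff sum.distrib distrib_right)

lemma matrix_diff_ldistrib: "A ** (B - C) = A ** B - A ** (C :: 'a::ring_1^'n^'m)"
  by (simp add: matrix_matrix_mult_def vec_eq_iff sum_subtractf right_diff_distrib)

lemma matrix_diff_rdistrib: "(B - C) ** A = B ** A - C ** (A :: 'a::ring_1^'n^'m)"
  by (simp add: matrix_matrix_mult_def vec_eq_iff sum_subtractf left_diff_distrib)

text \<open>
  Uniqueness of the group inverse: for two candidates \<open>G\<close> and \<open>G'\<close>, both \<open>M G\<close> and \<open>M G'\<close> equal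
  \<open>M G M G'\<close>, and \<open>G\<close> is recovered from the projection \<open>M G\<close>.
\<close>

lemma group_inverse_eqI:
  assumes "M ** G = G ** M" "G ** M ** G = G" "M ** G ** M = M"
  shows "group_inverse M = G"
  unfolding group_inverse_def
proof (rule the_equality)
  show "M ** G = G ** M \<and> G ** M ** G = G \<and> M ** G ** M = M"
    using assms by simp
  fix G' assume G': "M ** G' = G' ** M \<and> G' ** M ** G' = G' \<and> M ** G' ** M = M"
  have "M ** G' = M ** G"
    by (metis G' assms(1,3) matrix_mul_assoc)
  then show "G' = G"
    by (metis G' assms(1,2) matrix_mul_assoc)
qed

text \<open>
  Write \<open>N = M - \<mu> I\<close>. Since \<open>ker N\<^sup>2 = ker N = span x\<close>, the matrix \<open>N + x x\<^sup>H\<close> is injective, hence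
  surjective, and every vector is of the form \<open>N v + a x\<close>. A left null vector orthogonal to \<open>x\<close> would
  therefore be orthogonal to everything, so \<open>y\<^sup>H x \<noteq> 0\<close>. With the spectral projection \<open>P\<close>, the matrix
  \<open>B = N + P\<close> is invertible for the same reason, it commutes with \<open>P\<close>, and \<open>B\<^sup>-\<^sup>1 - P\<close> is the group
  inverse of \<open>N\<close>.
\<close>

lemma eigenvectors_nonorthogonal_and_group_inverse:
  fixes M :: "complex^'n^'n"
  assumes simple: "simple_eigenvalue M \<mu>" and unit: "unit_eigenvectors M \<mu> x y"
  defines "G \<equiv> group_inverse (M - mat \<mu>)"
  shows "hprod y x \<noteq> 0"
    and "G ** (M - mat \<mu>) = mat 1 - eigenprojection x y"
    and "G *v x = 0"
    and "cnj_vec y v* G = 0"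
    and "(M - mat \<mu>) ** G = mat 1 - eigenprojection x y"
proof -
  let ?N = "M - mat \<mu>"
  let ?P = "eigenprojection x y"
  have x1: "norm x = 1" "x \<noteq> 0" and y1: "norm y = 1"
    using unit by (auto simp: unit_eigenvectors_def)
  have Nx: "?N *v x = 0"
    using unit by (simp add: unit_eigenvectors_def matrix_vector_mult_diff_rdistrib mat_mult_vec)
  have yN: "cnj_vec y v* ?N = 0"
    using unit by (simp add: unit_eigenvectors_def vec_mult_diff_mat)
  then have hN: "hprod y (?N *v v) = 0" for v
    by (simp add: hprod_matrix)
  note ker = simple_eigenvalue_kernel[OF simple x1(2) Nx]
  have inj_imp_inv: "\<exists>B'. B' ** B = mat 1 \<and> B ** B' = mat 1"
    if "\<And>v. B *v v = 0 \<Longrightarrow> v = 0" for B :: "complex^'n^'n"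
    using that by (metis matrix_left_invertible_ker matrix_left_right_inverse)
  define K where "K = ?N + self_outer x"
  have K: "K *v v = ?N *v v + hprod x v *s x" for v
    by (simp add: K_def matrix_vector_mult_add_rdistrib self_outer_mult)
  have "v = 0" if "K *v v = 0" for v
  proof -
    have "?N *v v = (- hprod x v) *s x"
      using that by (simp add: K eq_neg_iff_add_eq_0)
    then obtain a where "v = a *s x"
      using ker by blast
    with that x1 show ?thesis
      by (simp add: K vec.scale Nx hprod_linear hprod_self)
  qed
  then obtain K' where K': "K ** K' = mat 1"
    using inj_imp_inv by blast
  show yx: "hprod y x \<noteq> 0"
  proof
    assume 0: "hprod y x = 0"
    have "hprod y y = hprod y (K *v (K' *v y))"
      using K' by (simp add: matrix_vector_mul_assoc)
    also have "\<dots> = 0"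
      unfolding K by (simp add: hprod_linear hN 0)
    finally show False
      using y1 by (simp add: hprod_self)
  qed
  have PN: "?P ** ?N = 0" and NP: "?N ** ?P = 0" and PP: "?P ** ?P = ?P"
    using yx by (simp_all add: matrix_eq eigenprojection_mult hN Nx vec.scale hprod_linear
        flip: matrix_vector_mul_assoc)
  define B where "B = ?N + ?P"
  have "v = 0" if "B *v v = 0" for v
  proof -
    have "?N *v v = (- (hprod y v / hprod y x)) *s x"
      using that by (simp add: B_def matrix_vector_mult_add_rdistrib eigenprojection_mult
          eq_neg_iff_add_eq_0)
    then obtain a where "v = a *s x"
      using ker by blast
    with that x1 yx show ?thesis
      by (simp add: B_def matrix_vector_mult_add_rdistrib eigenprojection_mult vec.scale Nx
          hprod_linear)
  qed
  then obtain B' where B': "B' ** B = mat 1" "B ** B' = mat 1"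
    using inj_imp_inv by blast
  have BP: "B ** ?P = ?P" "?P ** B = ?P"
    by (simp_all add: B_def matrix_add_ldistrib matrix_add_rdistrib PN NP PP)
  then have B'P: "B' ** ?P = ?P" "?P ** B' = ?P"
    by (metis B' matrix_mul_assoc matrix_mul_lid matrix_mul_rid)+
  have N: "?N = B - ?P" by (simp add: B_def)
  have GN: "(B' - ?P) ** ?N = mat 1 - ?P" and NG: "?N ** (B' - ?P) = mat 1 - ?P"
    unfolding N by (simp_all add: matrix_diff_ldistrib matrix_diff_rdistrib B' B'P BP PP)
  have "group_inverse ?N = B' - ?P"
  proof (rule group_inverse_eqI)
    show "?N ** (B' - ?P) = (B' - ?P) ** ?N"
      unfolding GN NG ..
    have "?P ** (B' - ?P) = 0"
      by (simp add: matrix_diff_ldistrib B'P PP)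
    then show "(B' - ?P) ** ?N ** (B' - ?P) = B' - ?P"
      unfolding GN by (subst matrix_diff_rdistrib) simp
    show "?N ** (B' - ?P) ** ?N = ?N"
      unfolding NG by (subst matrix_diff_rdistrib) (simp add: PN)
  qed
  then have G: "G = B' - ?P" by (simp add: G_def)
  show "G ** ?N = mat 1 - ?P" "?N ** G = mat 1 - ?P"
    by (simp_all add: G GN NG)
  have "?P *v x = x" using yx by (simp add: eigenprojection_mult)
  then have "B' *v x = x"
    by (metis B'P(1) matrix_vector_mul_assoc)
  then show "G *v x = 0"
    by (simp add: G matrix_vector_mult_diff_rdistrib \<open>?P *v x = x\<close>)
  have yP: "cnj_vec y v* ?P = cnj_vec y"
  proof -
    have "(cnj_vec y v* ?P) $ i = cnj_vec y $ i" for i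
    proof -
      have "(cnj_vec y v* ?P) $ i = (\<Sum>k\<in>UNIV. cnj (y $ k) * x $ k * (cnj (y $ i) / hprod y x))"
        unfolding vector_matrix_mult_def eigenprojection_def cnj_vec_def by (simp add: mult_ac)
      also have "\<dots> = hprod y x * (cnj (y $ i) / hprod y x)"
        by (simp only: hprod_def sum_distrib_right)
      finally show ?thesis
        using yx by (simp add: cnj_vec_def)
    qed
    then show ?thesis by (simp add: vec_eq_iff)
  qed
  then have "cnj_vec y v* B' = cnj_vec y"
    by (metis B'P(2) vector_matrix_mul_assoc)
  then show "cnj_vec y v* G = 0"
    using yP by (simp add: G vec_eq_iff vector_matrix_mult_def algebra_simps sum_subtractf)
qed

section \<open>Continuation of a simple eigenvalue\<close>

text \<open>
  The implicit function theorem for a simple root of a polynomial that depends continuously on a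
  parameter. With \<open>c\<close> the derivative at the root, the Newton-like map \<open>z - p(z) / c\<close> is a contraction
  with factor one half of a fixed disc for all nearby parameters. Its fixed points are the roots, and
  the contraction estimate bounds the distance between the roots at two parameters by the value of
  the polynomial of one parameter at the root of the other.
\<close>

lemma simple_root_continuation:
  fixes p :: "'a::t2_space \<Rightarrow> complex poly"
  assumes cont: "continuous_on UNIV (\<lambda>(F, z). poly (p F) z)"
    and cont': "continuous_on UNIV (\<lambda>(F, z). poly (pderiv (p F)) z)"
    and root: "poly (p E) z0 = 0" and simple: "poly (pderiv (p E)) z0 \<noteq> 0"
  obtains W \<eta> r where "open W" "E \<in> W" "\<eta> > 0" "continuous_on W r"
    "\<And>F. F \<in> W \<Longrightarrow> poly (p F) (r F) = 0 \<and> poly (pderiv (p F)) (r F) \<noteq> 0"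
    "\<And>F z. F \<in> W \<Longrightarrow> z \<in> cball z0 \<eta> \<Longrightarrow> poly (p F) z = 0 \<Longrightarrow> z = r F"
proof -
  define c where "c = poly (pderiv (p E)) z0"
  have c: "c \<noteq> 0" using simple by (simp add: c_def)
  \<comment> \<open>The set on which the contraction below has derivative less than one half; it contains \<open>(E, z0)\<close>.\<close>
  let ?O = "{x. norm (1 - (case x of (F, z) \<Rightarrow> poly (pderiv (p F)) z) / c) < 1/2}"
  have "open ?O"
    by (intro open_Collect_less continuous_intros cont') (use c in auto)
  moreover have "(E, z0) \<in> ?O"
    using c by (simp add: c_def)
  ultimately obtain W1 Z where WZ: "open W1" "open Z" "(E, z0) \<in> W1 \<times> Z" "W1 \<times> Z \<subseteq> ?O"
    by (rule open_prod_elim)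
  then obtain \<eta> where \<eta>: "\<eta> > 0" "cball z0 \<eta> \<subseteq> Z"
    using open_contains_cball by (metis mem_Sigma_iff)
  define W where "W = W1 \<inter> {F. norm (poly (p F) z0 / c) < \<eta> / 2}"
  have cont0: "continuous_on S (\<lambda>F. poly (p F) (f F))" if "continuous_on S f" for S f
    using continuous_on_compose2[OF cont, of S "\<lambda>F. (F, f F)"] that
    by (simp add: continuous_on_Pair continuous_on_id)
  have "open W"
    unfolding W_def
    by (intro open_Int WZ open_Collect_less continuous_intros cont0) (use c in auto)
  have "E \<in> W"
    using WZ \<eta> by (simp add: W_def root)
  define \<phi> where "\<phi> F z = z - poly (p F) z / c" for F z
  have lip: "dist (\<phi> F z) (\<phi> F z') \<le> 1/2 * dist z z'"
    if "F \<in> W" "z \<in> cball z0 \<eta>" "z' \<in> cball z0 \<eta>" for F z z'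
    unfolding dist_norm
  proof (rule field_differentiable_bound[of "cball z0 \<eta>"])
    fix t assume t: "t \<in> cball z0 \<eta>"
    show "(\<phi> F has_field_derivative 1 - poly (pderiv (p F)) t / c) (at t within cball z0 \<eta>)"
      unfolding \<phi>_def
      by (auto intro!: derivative_eq_intros poly_DERIV[THEN has_field_derivative_at_within] c)
    show "norm (1 - poly (pderiv (p F)) t / c) \<le> 1/2"
      using WZ(4) \<eta>(2) that(1) t by (force simp: W_def)
  qed (use that in auto)
  have fixp: "\<exists>!z\<in>cball z0 \<eta>. \<phi> F z = z" if F: "F \<in> W" for F
  proof (rule Banach_fix[where c="1/2"])
    show "\<phi> F ` cball z0 \<eta> \<subseteq> cball z0 \<eta>"
    proof clarify
      fix z assume z: "z \<in> cball z0 \<eta>"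
      have "dist z0 (\<phi> F z) \<le> dist z0 (\<phi> F z0) + dist (\<phi> F z0) (\<phi> F z)"
        by (rule dist_triangle)
      also have "dist z0 (\<phi> F z0) < \<eta> / 2"
        using F by (simp add: \<phi>_def W_def dist_norm)
      also have "dist (\<phi> F z0) (\<phi> F z) \<le> 1/2 * \<eta>"
        using lip[OF F _ z, of z0] z \<eta> by auto
      finally show "\<phi> F z \<in> cball z0 \<eta>" by simp
    qed
  qed (use \<eta> lip[OF F] in \<open>auto simp: complete_eq_closed\<close>)
  have fix_iff: "\<phi> F z = z \<longleftrightarrow> poly (p F) z = 0" for F z
    using c by (simp add: \<phi>_def)
  have "\<forall>F\<in>W. \<exists>z. z \<in> cball z0 \<eta> \<and> \<phi> F z = z"
    using fixp by blast
  then obtain r where r: "\<And>F. F \<in> W \<Longrightarrow> r F \<in> cball z0 \<eta>" "\<And>F. F \<in> W \<Longrightarrow> \<phi> F (r F) = r F"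
    by metis
  have uniq: "z = r F" if "F \<in> W" "z \<in> cball z0 \<eta>" "poly (p F) z = 0" for F z
    using fixp[OF that(1)] r[OF that(1)] that fix_iff by blast
  have close: "dist (r F') (r F) \<le> 2 * norm (poly (p F') (r F) / c)" if "F \<in> W" "F' \<in> W" for F F'
  proof -
    have "dist (r F') (r F) \<le> dist (\<phi> F' (r F')) (\<phi> F' (r F)) + dist (\<phi> F' (r F)) (r F)"
      by (metis dist_triangle r(2) that(2))
    also have "dist (\<phi> F' (r F')) (\<phi> F' (r F)) \<le> 1/2 * dist (r F') (r F)"
      by (intro lip r that)
    also have "dist (\<phi> F' (r F)) (r F) = norm (poly (p F') (r F) / c)"
      by (simp add: \<phi>_def dist_norm)
    finally show ?thesis by simp
  qed
  have "continuous_on W r"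
  proof (rule continuous_on_eq_continuous_at[OF \<open>open W\<close>, THEN iffD2], intro ballI)
    fix F assume F: "F \<in> W"
    have "((\<lambda>F'. 2 * norm (poly (p F') (r F) / c)) \<longlongrightarrow> 2 * norm (poly (p F) (r F) / c)) (at F)"
      using cont0[of UNIV "\<lambda>_. r F"] c
      by (auto intro!: tendsto_intros simp: continuous_on_def)
    moreover have "2 * norm (poly (p F) (r F) / c) = 0"
      using r(2)[OF F] fix_iff by simp
    ultimately have lim: "((\<lambda>F'. 2 * norm (poly (p F') (r F) / c)) \<longlongrightarrow> 0) (at F)"
      by (simp only:)
    have "\<forall>\<^sub>F F' in at F. F' \<in> W"
      using F \<open>open W\<close> by (auto simp: eventually_at_topological)
    then have "\<forall>\<^sub>F F' in at F. dist (r F') (r F) \<le> 2 * norm (poly (p F') (r F) / c)"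
      by eventually_elim (rule close[OF F])
    then have "((\<lambda>F'. dist (r F') (r F)) \<longlongrightarrow> 0) (at F)"
      by (intro tendsto_sandwich[OF _ _ tendsto_const lim]) auto
    then show "isCont r F"
      unfolding isCont_def using tendsto_dist_iff by blast
  qed
  moreover have "poly (p F) (r F) = 0 \<and> poly (pderiv (p F)) (r F) \<noteq> 0" if F: "F \<in> W" for F
  proof -
    have "(F, r F) \<in> W1 \<times> Z"
      using r(1)[OF F] F \<eta>(2) by (auto simp: W_def)
    then have "(F, r F) \<in> ?O"
      by (rule subsetD[OF WZ(4)])
    then show ?thesis
      using r(2)[OF F] fix_iff by auto
  qed
  ultimately show thesis
    using that \<open>open W\<close> \<open>E \<in> W\<close> \<eta>(1) uniq by blast
qed


text \<open>
  These are the two continuity conditions required for the continuation of a root. They survive sums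
  and products, so they pass through the Leibniz formula to the characteristic polynomial without
  any reference to its degree or its coefficients.
\<close>

definition continuous_poly_family :: "('a::topological_space \<Rightarrow> complex poly) \<Rightarrow> bool" where
  "continuous_poly_family p \<longleftrightarrow> continuous_on UNIV (\<lambda>(F, z). poly (p F) z) \<and>
     continuous_on UNIV (\<lambda>(F, z). poly (pderiv (p F)) z)"

lemma continuous_poly_family_const: "continuous_poly_family (\<lambda>F. q)"
  by (auto simp: continuous_poly_family_def split_def intro!: continuous_intros)

lemma continuous_poly_family_linear:
  assumes "continuous_on UNIV f"
  shows "continuous_poly_family (\<lambda>F. [:f F, a:])"
proof -
  have "continuous_on UNIV (\<lambda>x :: 'a \<times> complex. f (fst x))"
    by (rule continuous_on_compose2[OF assms]) (auto intro: continuous_intros)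
  then show ?thesis
    by (auto simp: continuous_poly_family_def split_def pderiv_pCons intro!: continuous_intros)
qed

lemma continuous_poly_family_add: "continuous_poly_family p \<Longrightarrow> continuous_poly_family q \<Longrightarrow> continuous_poly_family (\<lambda>F. p F + q F)"
  by (auto simp: continuous_poly_family_def split_def pderiv_add intro!: continuous_intros)

lemma continuous_poly_family_mult: "continuous_poly_family p \<Longrightarrow> continuous_poly_family q \<Longrightarrow> continuous_poly_family (\<lambda>F. p F * q F)"
  by (auto simp: continuous_poly_family_def split_def pderiv_mult intro!: continuous_intros)

lemma continuous_poly_family_sum:
  "(\<And>i. i \<in> I \<Longrightarrow> continuous_poly_family (p i)) \<Longrightarrow> continuous_poly_family (\<lambda>F. \<Sum>i\<in>I. p i F)"
  by (induction I rule: infinite_finite_induct) (auto intro: continuous_poly_family_const continuous_poly_family_add)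

lemma continuous_poly_family_prod:
  "(\<And>i. i \<in> I \<Longrightarrow> continuous_poly_family (p i)) \<Longrightarrow> continuous_poly_family (\<lambda>F. \<Prod>i\<in>I. p i F)"
  by (induction I rule: infinite_finite_induct) (auto intro: continuous_poly_family_const continuous_poly_family_mult)

lemma continuous_poly_family_charpoly:
  assumes "continuous_on UNIV (M :: 'a::topological_space \<Rightarrow> complex^'n^'n)"
  shows "continuous_poly_family (\<lambda>F. charpoly (M F))"
proof -
  have "continuous_poly_family (\<lambda>F. (mat [:0, 1:] - map_matrix (\<lambda>c. [:c:]) (M F)) $ i $ j)" for i j
  proof -
    have "(\<lambda>F. (mat [:0, 1:] - map_matrix (\<lambda>c. [:c:]) (M F)) $ i $ j) =
        (\<lambda>F. [:- (M F $ i $ j), if i = j then 1 else 0:])"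
      by (auto simp: mat_def)
    moreover have "continuous_poly_family (\<lambda>F. [:- (M F $ i $ j), if i = j then 1 else 0:])"
      by (intro continuous_poly_family_linear continuous_intros assms)
    ultimately show ?thesis by simp
  qed
  then show ?thesis
    unfolding charpoly_def det_def
    by (intro continuous_poly_family_sum continuous_poly_family_mult continuous_poly_family_const continuous_poly_family_prod)
qed

lemma exists_unit_eigenvectors:
  assumes "poly (charpoly M) \<mu> = 0"
  shows "\<exists>x y. unit_eigenvectors M \<mu> x y"
proof -
  obtain x where x: "norm x = 1" "M *v x = \<mu> *s x"
    using exists_eigenvector[OF assms] by blast
  obtain w where w: "norm w = 1" "transpose M *v w = \<mu> *s w"
    using exists_eigenvector[of "transpose M" \<mu>] assms by (auto simp: charpoly_transpose)
  have "cnj_vec (cnj_vec w) = w" "norm (cnj_vec w) = norm w"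
    by (simp_all add: cnj_vec_def vec_eq_iff norm_vec_def)
  then have "unit_eigenvectors M \<mu> x (cnj_vec w)"
    using x w by (simp add: unit_eigenvectors_def transpose_matrix_vector)
  then show ?thesis by blast
qed

lemma continuous_complexify: "continuous_on S (\<lambda>F. complexify (A + \<epsilon> *\<^sub>R F))"
  unfolding complexify_def map_matrix_def
  by (intro continuous_intros)

text \<open>
  The eigenvalue prescribed on the sphere is continuous there, so near \<open>E\<close> it stays in the disc in
  which the continued root is the only one; hence the continuation extends it. The eigenvectors are
  chosen arbitrarily off the sphere.
\<close>

lemma local_extension_exists:
  fixes A :: "real^'n^'n"
  assumes cont: "continuous_on R1 \<mu>"
    and data: "eigendata_on R1 A \<epsilon> \<mu> x y"
    and E: "E \<in> R1"
  shows "\<exists>W \<mu>' x' y'. local_extension A \<epsilon> \<mu> x y E W \<mu>' x' y'"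
proof -
  let ?M = "\<lambda>F :: real^'n^'n. complexify (A + \<epsilon> *\<^sub>R F)"
  have C1: "continuous_poly_family (\<lambda>F. charpoly (?M F))"
    by (intro continuous_poly_family_charpoly continuous_complexify)
  have "simple_eigenvalue (?M E) (\<mu> E)"
    using data E by (simp add: eigendata_on_def)
  then have "poly (charpoly (?M E)) (\<mu> E) = 0" "poly (pderiv (charpoly (?M E))) (\<mu> E) \<noteq> 0"
    by (simp_all add: simple_eigenvalue_iff)
  note simple_root = this
  obtain W0 \<eta> r where W0: "open W0" "E \<in> W0" "\<eta> > 0" "continuous_on W0 r"
    "\<And>F. F \<in> W0 \<Longrightarrow> poly (charpoly (?M F)) (r F) = 0 \<and> poly (pderiv (charpoly (?M F))) (r F) \<noteq> 0"
    and uniq: "\<And>F z. F \<in> W0 \<Longrightarrow> z \<in> cball (\<mu> E) \<eta> \<Longrightarrow> poly (charpoly (?M F)) z = 0 \<Longrightarrow> z = r F"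
    by (rule simple_root_continuation[OF conjunct1[OF C1[unfolded continuous_poly_family_def]]
          conjunct2[OF C1[unfolded continuous_poly_family_def]] simple_root]) (erule that)
  have "\<exists>T. open T \<and> T \<inter> R1 = \<mu> -` ball (\<mu> E) \<eta> \<inter> R1"
    using cont by (auto simp: continuous_on_open_invariant)
  then obtain T where T: "open T" "T \<inter> R1 = \<mu> -` ball (\<mu> E) \<eta> \<inter> R1"
    by (elim exE conjE) (rule that)
  define W where "W = W0 \<inter> T"
  have r_eq: "r F = \<mu> F" if F: "F \<in> W \<inter> R1" for F
  proof -
    have "F \<in> T \<inter> R1" using F by (simp add: W_def)
    then have "\<mu> F \<in> cball (\<mu> E) \<eta>"
      unfolding T(2) by auto
    moreover have "poly (charpoly (?M F)) (\<mu> F) = 0"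
      using data F by (simp add: eigendata_on_def simple_eigenvalue_iff)
    ultimately show ?thesis
      using uniq[of F "\<mu> F"] F by (simp add: W_def)
  qed
  have "E \<in> T"
    using T(2) E W0(3) by auto
  have "\<exists>x y. unit_eigenvectors (?M F) (r F) x y" if "F \<in> W" for F
    by (rule exists_unit_eigenvectors) (use W0(5)[of F] that in \<open>simp add: W_def\<close>)
  then have "\<forall>F\<in>W. \<exists>x y. unit_eigenvectors (?M F) (r F) x y"
    by simp
  then obtain x0 y0 where xy0: "\<forall>F\<in>W. unit_eigenvectors (?M F) (r F) (x0 F) (y0 F)"
    unfolding bchoice_iff by (elim exE) (rule that)
  have "local_extension A \<epsilon> \<mu> x y E W r (\<lambda>F. if F \<in> R1 then x F else x0 F)
      (\<lambda>F. if F \<in> R1 then y F else y0 F)"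
    unfolding local_extension_def
  proof (intro conjI)
    show "open W" "E \<in> W" "continuous_on W r"
      using W0 T \<open>E \<in> T\<close> by (auto simp: W_def intro: continuous_on_subset)
    show "eigendata_on W A \<epsilon> r (\<lambda>F. if F \<in> R1 then x F else x0 F)
        (\<lambda>F. if F \<in> R1 then y F else y0 F)"
      using W0(5) xy0 r_eq data by (auto simp: eigendata_on_def simple_eigenvalue_iff W_def)
  qed (use r_eq in auto)
  then show ?thesis by blast
qed

section \<open>Derivative of the eigenvectors\<close>

lemma bounded_bilinear_matrix_vector_mult:
  "bounded_bilinear ((*v) ::
     ('a :: {real_normed_field, euclidean_space})^'n^'m \<Rightarrow> 'a^'n \<Rightarrow> 'a^'m)"
  by (rule bilinear_conv_bounded_bilinear[THEN iffD1])
    (auto simp: bilinear_def linear_iff matrix_vector_mult_def vec_eq_iff scaleR_sum_right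
      distrib_left distrib_right sum.distrib)

text \<open>
  Scale the eigenvector at \<open>F\<close> to a vector \<open>u\<close> with \<open>y\<^sup>H u = y\<^sup>H x\<close>. With \<open>d\<close> and \<open>H\<close> the increments of
  the eigenvalue and of the matrix, the eigenvalue equation multiplied by \<open>G\<close> becomes
  \<open>u - x = d G (u - x) - G H u\<close>. As \<open>d\<close> tends to zero, this gives \<open>u - x = O(H)\<close> and then
  \<open>u - x = - G H x + o(H)\<close>. The scaling removes the arbitrary phases of the given eigenvectors.
\<close>

lemma normalized_eigenvector_derivative:
  fixes M :: "'a::real_normed_vector \<Rightarrow> complex^'n^'n"
  assumes L: "bounded_linear L" and M: "\<And>F. M F = M E + L (F - E)"
    and \<mu>: "isCont \<mu> E"
    and x: "\<forall>\<^sub>F F in nhds E. M F *v x F = \<mu> F *s x F \<and> norm (x F) = 1"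
    and y: "norm y = 1" and yx: "hprod y (x E) \<noteq> 0"
    and GN: "G ** (M E - mat (\<mu> E)) = mat 1 - eigenprojection (x E) y"
    and Gx: "G *v x E = 0"
  defines "u \<equiv> \<lambda>F. (hprod y (x E) / hprod y (x F)) *s x F"
  shows "(u has_derivative (\<lambda>h. - (G *v (L h *v x E)))) (at E)"
    and "\<forall>\<^sub>F F in nhds E. hprod y (x F) \<noteq> 0"
proof -
  interpret mv: bounded_bilinear "(*v) :: complex^'n^'n \<Rightarrow> complex^'n \<Rightarrow> complex^'n"
    by (rule bounded_bilinear_matrix_vector_mult)
  obtain b where b: "b > 0" "\<And>(K :: complex^'n^'n) v. norm (K *v v) \<le> b * norm K * norm v"
    using mv.pos_bounded by (metis mult.commute mult.left_commute)
  interpret L: bounded_linear L by (rule L)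
  obtain l where l: "l \<ge> 0" "\<And>h. norm (L h) \<le> norm h * l"
    using L.nonneg_bounded by blast
  define d where "d F = \<mu> F - \<mu> E" for F
  define H where "H F = L (F - E)" for F
  define g where "g = b * norm G"
  have g: "g \<ge> 0" "norm (G *v v) \<le> g * norm v" for v
    using b by (simp_all add: g_def)
  have d0: "(d \<longlongrightarrow> 0) (nhds E)"
    using \<mu> unfolding d_def isCont_def
    by (intro LIM_zero) (simp add: tendsto_nhds_iff)
  have Hb: "norm (H F *v v) \<le> b * l * norm (F - E) * norm v" for F v
  proof -
    have "norm (H F *v v) \<le> b * norm (H F) * norm v" by (rule b)
    also have "\<dots> \<le> b * (norm (F - E) * l) * norm v"
      unfolding H_def using b l by (intro mult_right_mono mult_left_mono) auto
    finally show ?thesis by (simp add: mult_ac)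
  qed
  \<comment> \<open>The eigenvalue equation multiplied by \<open>G\<close>, for eigenvectors of any length.\<close>
  have res: "v - (hprod y v / hprod y (x E)) *s x E = d F *s (G *v v) - G *v (H F *v v)"
    if "M F *v v = \<mu> F *s v" for F v
  proof -
    have "(M E - mat (\<mu> E)) *v v = d F *s v - H F *v v"
      using that unfolding M[of F]
      by (simp add: d_def H_def matrix_vector_mult_diff_rdistrib matrix_vector_mult_add_rdistrib
          mat_mult_vec vec_eq_iff algebra_simps) 
    then have "G *v ((M E - mat (\<mu> E)) *v v) = d F *s (G *v v) - G *v (H F *v v)"
      by (simp only: matrix_vector_mult_diff_distrib vec.scale)
    moreover have "G *v ((M E - mat (\<mu> E)) *v v) = v - (hprod y v / hprod y (x E)) *s x E"
      unfolding matrix_vector_mul_assoc GN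
      by (simp add: matrix_vector_mult_diff_rdistrib eigenprojection_mult)
    ultimately show ?thesis by simp
  qed
  have bnd: "\<forall>\<^sub>F F in nhds E. g * norm (d F) + g * (b * l * norm (F - E)) < 1/2"
  proof (rule order_tendstoD)
    have "((\<lambda>F. g * norm (d F) + g * (b * l * norm (F - E))) \<longlongrightarrow>
        g * norm (0::complex) + g * (b * l * norm (E - E))) (nhds E)"
      by (intro tendsto_intros d0 filterlim_ident)
    then show "((\<lambda>F. g * norm (d F) + g * (b * l * norm (F - E))) \<longlongrightarrow> 0) (nhds E)"
      by simp
  qed simp
  \<comment> \<open>The component of a unit eigenvector outside the span of \<open>x E\<close> is less than one half near \<open>E\<close>,
    so the other component cannot vanish.\<close>
  show nz: "\<forall>\<^sub>F F in nhds E. hprod y (x F) \<noteq> 0"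
    using x bnd
  proof eventually_elim
    case (elim F)
    show ?case
    proof
      assume "hprod y (x F) = 0"
      then have "norm (x F) = norm (d F *s (G *v x F) - G *v (H F *v x F))"
        using res[of F "x F"] elim(1) by simp
      also have "\<dots> \<le> norm (d F) * (g * 1) + g * (b * l * norm (F - E) * 1)"
        using g(2)[of "x F"] order_trans[OF g(2) mult_left_mono[OF Hb g(1)], of "F" "x F"] elim(1)
        by (intro order_trans[OF norm_triangle_ineq4] add_mono) (auto simp: norm_smult mult_left_mono)
      also have "\<dots> < 1/2"
        using elim(2) by (simp add: mult_ac)
      finally show False using elim(1) by simp
    qed
  qed
  have uE: "u E = x E"
    using yx by (simp add: u_def)
  have xE: "norm (x E) = 1"
    using eventually_nhds_x_imp_x[OF x] by simp
  have rel: "\<forall>\<^sub>F F in nhds E. u F - x E = d F *s (G *v (u F - x E)) - G *v (H F *v u F)"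
    using x nz
  proof eventually_elim
    case (elim F)
    have "M F *v u F = \<mu> F *s u F"
      using elim(1) by (simp add: u_def vec.scale vec_eq_iff mult_ac)
    moreover have "hprod y (u F) = hprod y (x E)"
      using elim(2) by (simp add: u_def hprod_linear)
    ultimately have "u F - x E = d F *s (G *v u F) - G *v (H F *v u F)"
      using res[of F "u F"] yx by simp
    moreover have "G *v (u F - x E) = G *v u F"
      by (simp add: matrix_vector_mult_diff_distrib Gx)
    ultimately show ?case by simp
  qed
  define C where "C = 2 * g * (b * l) * 2"
  have small: "\<forall>\<^sub>F F in nhds E. norm (u F - x E) \<le> C * norm (F - E)"
    using rel bnd
  proof eventually_elim
    case (elim F)
    let ?e = "norm (u F - x E)" and ?f = "norm (F - E)"
    have "?e \<le> norm (d F) * norm (G *v (u F - x E)) + norm (G *v (H F *v u F))"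
      by (subst elim(1)) (metis norm_triangle_ineq4 norm_smult)
    also have "\<dots> \<le> norm (d F) * (g * ?e) + g * (b * l * ?f * norm (u F))"
      by (intro add_mono mult_left_mono g order_trans[OF g(2)] Hb) auto
    also have "\<dots> \<le> norm (d F) * (g * ?e) + g * (b * l * ?f * (?e + 1))"
    proof -
      have "norm (u F) \<le> ?e + 1"
        using norm_triangle_ineq[of "u F - x E" "x E"] xE by simp
      then show ?thesis
        using g(1) b l by (intro add_left_mono mult_left_mono) auto
    qed
    also have "\<dots> = (g * norm (d F) + g * (b * l * ?f)) * ?e + g * (b * l) * ?f"
      by (simp add: algebra_simps)
    also have "\<dots> \<le> 1/2 * ?e + g * (b * l) * ?f"
      using elim(2) by (intro add_right_mono mult_right_mono) auto
    finally have "?e \<le> 2 * (g * (b * l) * ?f)" by simp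
    also have "\<dots> \<le> C * ?f"
      using g(1) b l by (simp add: C_def)
    finally show ?case .
  qed
  show "(u has_derivative (\<lambda>h. - (G *v (L h *v x E)))) (at E)"
    unfolding has_derivative_iff_norm
  proof (intro conjI)
    have bl: "bounded_linear (\<lambda>K :: complex^'n^'n. - (G *v (K *v x E)))"
      by (intro bounded_linear_minus bounded_linear_compose[OF mv.bounded_linear_right mv.bounded_linear_left])
    show "bounded_linear (\<lambda>h. - (G *v (L h *v x E)))"
      using bounded_linear_compose[OF bl L] by simp
    have C: "C \<ge> 0"
      using g(1) b l by (simp add: C_def)
    have rem: "\<forall>\<^sub>F F in nhds E. norm (norm (u F - u E - - (G *v (L (F - E) *v x E))) / norm (F - E))
        \<le> (norm (d F) * g + g * (b * l * norm (F - E))) * C"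
      using rel small
    proof eventually_elim
      case (elim F)
      let ?e = "norm (u F - x E)" and ?f = "norm (F - E)"
      have "u F - u E - - (G *v (L (F - E) *v x E)) = u F - x E + G *v (H F *v x E)"
        by (simp add: uE H_def)
      also have "\<dots> = d F *s (G *v (u F - x E)) - G *v (H F *v (u F - x E))"
        by (subst elim(1)) (simp add: matrix_vector_mult_diff_distrib)
      finally have "norm (u F - u E - - (G *v (L (F - E) *v x E))) \<le>
          norm (d F) * norm (G *v (u F - x E)) + norm (G *v (H F *v (u F - x E)))"
        by (metis norm_triangle_ineq4 norm_smult)
      also have "\<dots> \<le> norm (d F) * (g * ?e) + g * (b * l * ?f * ?e)"
        by (intro add_mono mult_left_mono g order_trans[OF g(2)] Hb) auto
      also have "\<dots> = (norm (d F) * g + g * (b * l * ?f)) * ?e"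
        by (simp add: algebra_simps)
      also have "\<dots> \<le> (norm (d F) * g + g * (b * l * ?f)) * (C * ?f)"
        using elim(2) g(1) b l by (intro mult_left_mono) auto
      finally have "norm (u F - u E - - (G *v (L (F - E) *v x E))) \<le>
          (norm (d F) * g + g * (b * l * ?f)) * C * ?f"
        by (simp add: mult_ac)
      then show ?case
        using g(1) b l C by (cases "?f = 0") (simp_all add: divide_le_eq)
    qed
    have "((\<lambda>F. (norm (d F) * g + g * (b * l * norm (F - E))) * C) \<longlongrightarrow>
        (norm (0::complex) * g + g * (b * l * norm (E - E))) * C) (nhds E)"
      by (intro tendsto_intros d0 filterlim_ident)
    then have "((\<lambda>F. (norm (d F) * g + g * (b * l * norm (F - E))) * C) \<longlongrightarrow> 0) (nhds E)"
      by simp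
    from Lim_null_comparison[OF rem this]
    have "((\<lambda>F. norm (u F - u E - - (G *v (L (F - E) *v x E))) / norm (F - E)) \<longlongrightarrow> 0) (nhds E)" .
    then show "((\<lambda>F. norm (u F - u E - - (G *v (L (F - E) *v x E))) / norm (F - E)) \<longlongrightarrow> 0) (at E)"
      by (rule tendsto_mono[rotated]) (simp add: at_within_def)
  qed
qed

section \<open>Gradient of the modulus of \<open>y\<^sup>H x\<close>\<close>

lemma inner_eq_Re_hprod: "a \<bullet> b = Re (hprod b a)" for a b :: "complex^'n"
  by (simp add: inner_vec_def hprod_def inner_complex_def algebra_simps)

text \<open>
  The matrix \<open>S\<close> is the one representing the linear form \<open>K \<mapsto> y\<^sup>H K G y + x\<^sup>H G K x\<close> in the trace inner
  product; up to a positive factor, the real part of this form is the derivative of \<open>|y\<^sup>H x|\<close> below.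
\<close>

lemma inner_Re_matrix_S:
  fixes G :: "complex^'n^'n"
  shows "k \<bullet> Re_matrix (self_outer y ** hermitian_transpose G + hermitian_transpose G ** self_outer x) =
    Re (hprod y (complexify k *v (G *v y))) + Re (hprod x (G *v (complexify k *v x)))"
proof -
  have 1: "(self_outer y ** hermitian_transpose G) $ i $ j = y $ i * cnj ((G *v y) $ j)" for i j
    by (simp add: matrix_matrix_mult_def self_outer_def hermitian_transpose_def transpose_def
        matrix_vector_mult_def sum_distrib_left mult_ac)
  have 2: "(hermitian_transpose G ** self_outer x) $ i $ j = cnj ((cnj_vec x v* G) $ i) * cnj (x $ j)" for i j
    by (simp add: matrix_matrix_mult_def self_outer_def hermitian_transpose_def transpose_def
        vector_matrix_mult_def cnj_vec_def sum_distrib_left sum_distrib_right mult_ac)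
  have 3: "Re (hprod z (complexify k *v w)) =
      (\<Sum>i\<in>UNIV. \<Sum>j\<in>UNIV. k $ i $ j * Re (z $ i * cnj (w $ j)))" for z w
    by (simp add: hprod_def matrix_vector_mult_def complexify_def sum_distrib_left algebra_simps
        flip: sum.distrib)
  have 4: "hprod x (G *v w) = hprod (cnj_vec (cnj_vec x v* G)) w" for w
    unfolding hprod_matrix by (simp add: hprod_def cnj_vec_def)
  show ?thesis
    unfolding 3 4
    by (simp add: inner_vec_def Re_matrix_def 1 2 sum.distrib cnj_vec_def distrib_left)
qed

lemma hprod_cnj_vec: "hprod (cnj_vec x) (cnj_vec y) = hprod y x"
  by (simp add: hprod_def cnj_vec_def mult.commute)

lemma norm_cnj_vec: "norm (cnj_vec x) = norm x"
  by (simp add: cnj_vec_def norm_vec_def)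

lemma cnj_vec_cnj_vec: "cnj_vec (cnj_vec x) = x"
  by (simp add: cnj_vec_def vec_eq_iff)

lemma hprod_transpose: "hprod (cnj_vec a) (transpose K *v b) = hprod (cnj_vec (K *v a)) b"
  by (subst hprod_matrix) (simp add: hprod_alt cnj_vec_cnj_vec)

lemma transpose_eigenprojection:
  "transpose (eigenprojection x y) = eigenprojection (cnj_vec y) (cnj_vec x)"
  by (simp add: eigenprojection_def transpose_def vec_eq_iff hprod_cnj_vec)
     (simp add: cnj_vec_def mult.commute)

lemma transpose_diff: "transpose (M - N) = transpose M - transpose N"
  by (simp add: vec_eq_iff transpose_def)

lemma bounded_linear_transpose: "bounded_linear (transpose :: complex^'n^'n \<Rightarrow> complex^'n^'n)"
  by (intro linear_conv_bounded_linear[THEN iffD1]) (auto simp: linear_iff transpose_def vec_eq_iff)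

lemma bounded_linear_complexify: "bounded_linear (\<lambda>h :: real^'n^'n. complexify (\<epsilon> *\<^sub>R h))"
  by (intro linear_conv_bounded_linear[THEN iffD1])
    (auto simp: linear_iff complexify_def vec_eq_iff complex_eq_iff algebra_simps)

text \<open>
  Replace the eigenvectors by the differentiable normalized ones: \<open>u\<close> for the right one, and \<open>v\<close> for the
  conjugate of the left one, which is a right eigenvector of the transposed matrix. Then
  \<open>|y\<^sup>H x| = |v\<^sup>T u| / (\<parallel>u\<parallel> \<parallel>v\<parallel>)\<close>. The numerator is stationary because \<open>y\<^sup>H G = 0\<close> and \<open>G x = 0\<close>, so only
  the derivatives of the two norms contribute; they yield the two summands of \<open>S\<close>.
\<close>

lemma gradient_eigenvector_product:
  fixes A :: "real^'n^'n"
  assumes W: "open W" "E \<in> W" and cont: "continuous_on W \<mu>"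
    and data: "eigendata_on W A \<epsilon> \<mu> x y"
  shows "GDERIV (\<lambda>F. cmod (hprod (y F) (x F))) E :>
    (\<epsilon> * cmod (hprod (y E) (x E))) *\<^sub>R ReS A \<epsilon> \<mu> x y E"
proof -
  define M where "M F = complexify (A + \<epsilon> *\<^sub>R F)" for F
  define L :: "real^'n^'n \<Rightarrow> complex^'n^'n" where "L h = complexify (\<epsilon> *\<^sub>R h)" for h
  define G where "G = group_inverse (M E - mat (\<mu> E))"
  have L: "bounded_linear L"
    unfolding L_def by (rule bounded_linear_complexify)
  have M_affine: "M F = M E + L (F - E)" for F
    by (simp add: M_def L_def complexify_def vec_eq_iff algebra_simps)
  have ev: "simple_eigenvalue (M F) (\<mu> F)" "unit_eigenvectors (M F) (\<mu> F) (x F) (y F)"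
    if "F \<in> W" for F
    using data that by (simp_all add: eigendata_on_def M_def)
  have inW: "\<forall>\<^sub>F F in nhds E. F \<in> W"
    using W by (rule eventually_nhds_in_open)
  have \<mu>: "isCont \<mu> E"
    using cont W by (simp add: continuous_on_eq_continuous_at)
  define s where "s = hprod (y E) (x E)"
  note gi = eigenvectors_nonorthogonal_and_group_inverse[OF ev[OF W(2)], folded G_def]
  have s: "s \<noteq> 0" using gi(1) by (simp add: s_def)
  have unit: "norm (x E) = 1" "norm (y E) = 1"
    using ev(2)[OF W(2)] by (auto simp: unit_eigenvectors_def)
  define u where "u F = (s / hprod (y E) (x F)) *s x F" for F
  define v where "v F = (s / hprod (cnj_vec (x E)) (cnj_vec (y F))) *s cnj_vec (y F)" for F
  have "\<forall>\<^sub>F F in nhds E. M F *v x F = \<mu> F *s x F \<and> norm (x F) = 1"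
    using inW by eventually_elim (use ev(2) in \<open>auto simp: unit_eigenvectors_def\<close>)
  from normalized_eigenvector_derivative[OF L M_affine \<mu> this unit(2) gi(1) gi(2) gi(3)]
  have u: "(u has_derivative (\<lambda>h. - (G *v (L h *v x E)))) (at E)"
    and nzu: "\<forall>\<^sub>F F in nhds E. hprod (y E) (x F) \<noteq> 0"
    by (simp_all add: u_def[abs_def] s_def)
  have yEv: "\<forall>\<^sub>F F in nhds E. transpose (M F) *v cnj_vec (y F) = \<mu> F *s cnj_vec (y F) \<and>
      norm (cnj_vec (y F)) = 1"
    using inW
    by eventually_elim
      (use ev(2) in \<open>auto simp: unit_eigenvectors_def transpose_matrix_vector norm_cnj_vec\<close>)
  have L': "bounded_linear (\<lambda>h. transpose (L h))"
    by (rule bounded_linear_compose[OF bounded_linear_transpose L])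
  have M_affine': "transpose (M F) = transpose (M E) + transpose (L (F - E))" for F
    by (subst M_affine) (simp add: transpose_def vec_eq_iff)
  have GN': "transpose G ** (transpose (M E) - mat (\<mu> E)) =
      mat 1 - eigenprojection (cnj_vec (y E)) (cnj_vec (x E))"
    using arg_cong[OF gi(5), of transpose]
    by (simp add: matrix_transpose_mul transpose_diff transpose_eigenprojection)
  have Gy': "transpose G *v cnj_vec (y E) = 0"
    using gi(4) by (simp add: transpose_matrix_vector)
  have nz': "hprod (cnj_vec (x E)) (cnj_vec (y E)) \<noteq> 0" and nx': "norm (cnj_vec (x E)) = 1"
    using s unit by (simp_all add: hprod_cnj_vec norm_cnj_vec s_def)
  from normalized_eigenvector_derivative[where M="\<lambda>F. transpose (M F)" and L="\<lambda>h. transpose (L h)"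
      and x="\<lambda>F. cnj_vec (y F)", OF L' M_affine' \<mu> yEv nx' nz' GN' Gy']
  have v: "(v has_derivative (\<lambda>h. - (transpose G *v (transpose (L h) *v cnj_vec (y E))))) (at E)"
    and nzv: "\<forall>\<^sub>F F in nhds E. hprod (cnj_vec (x E)) (cnj_vec (y F)) \<noteq> 0"
    by (simp_all add: v_def[abs_def] s_def hprod_cnj_vec)
  have uE: "u E = x E" and vE: "v E = cnj_vec (y E)"
    using s by (simp_all add: u_def v_def s_def hprod_cnj_vec)
  define q where "q F = (\<Sum>i\<in>UNIV. v F $ i * u F $ i)" for F
  have qE: "q E = s"
    by (simp add: q_def uE vE s_def hprod_alt)
  have "(q has_derivative (\<lambda>h. 0)) (at E)"
  proof -
    have "(q has_derivative (\<lambda>h. \<Sum>i\<in>UNIV. v E $ i * (- (G *v (L h *v x E))) $ i +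
        (- (transpose G *v (transpose (L h) *v cnj_vec (y E)))) $ i * u E $ i)) (at E)"
      unfolding q_def
      by (intro has_derivative_sum has_derivative_mult
          bounded_linear.has_derivative[OF bounded_linear_vec_nth] u v)
    moreover have "(\<Sum>i\<in>UNIV. v E $ i * (- (G *v (L h *v x E))) $ i +
        (- (transpose G *v (transpose (L h) *v cnj_vec (y E)))) $ i * u E $ i) = 0" for h
    proof -
      have "hprod (y E) (G *v (L h *v x E)) = 0"
        by (simp add: hprod_matrix gi(4))
      moreover have "hprod (cnj_vec (x E)) (transpose G *v (transpose (L h) *v cnj_vec (y E))) = 0"
        unfolding hprod_matrix cnj_vec_cnj_vec
        by (simp add: gi(3))
      ultimately show ?thesis
        by (simp add: hprod_alt cnj_vec_cnj_vec uE vE sum.distrib sum_subtractf sum_negf mult.commute)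
    qed
    ultimately show ?thesis by simp
  qed
  from has_derivative_compose[OF this has_derivative_norm] s
  have q': "((\<lambda>F. cmod (q F)) has_derivative (\<lambda>h. 0)) (at E)"
    by (simp add: qE)
  have sgn: "sgn (x E) = x E" "sgn (cnj_vec (y E)) = cnj_vec (y E)"
    using unit by (simp_all add: sgn_div_norm norm_cnj_vec)
  have n1: "norm (u E) = 1" "norm (v E) = 1"
    using unit by (simp_all add: uE vE norm_cnj_vec)
  then have nz: "u E \<noteq> 0" "v E \<noteq> 0"
    by auto
  from has_derivative_compose[OF u has_derivative_norm[OF nz(1)]]
  have nu: "((\<lambda>F. norm (u F)) has_derivative (\<lambda>h. - (G *v (L h *v x E)) \<bullet> x E)) (at E)"
    by (simp add: uE sgn)
  from has_derivative_compose[OF v has_derivative_norm[OF nz(2)]]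
  have nv: "((\<lambda>F. norm (v F)) has_derivative
      (\<lambda>h. - (transpose G *v (transpose (L h) *v cnj_vec (y E))) \<bullet> cnj_vec (y E))) (at E)"
    by (simp add: vE sgn)
  have quot: "((\<lambda>F. cmod (q F) / (norm (u F) * norm (v F))) has_derivative
      (\<lambda>h. cmod s * ((G *v (L h *v x E)) \<bullet> x E +
        (transpose G *v (transpose (L h) *v cnj_vec (y E))) \<bullet> cnj_vec (y E)))) (at E)"
    by (rule has_derivative_eq_rhs[OF has_derivative_divide'[OF q' has_derivative_mult[OF nu nv]]])
      (use n1 in \<open>auto simp: qE algebra_simps\<close>)
  have eq: "\<forall>\<^sub>F F in nhds E. cmod (q F) / (norm (u F) * norm (v F)) = cmod (hprod (y F) (x F))"
    using nzu nzv inW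
  proof eventually_elim
    case (elim F)
    have "q F = s / hprod (y E) (x F) * (s / hprod (cnj_vec (x E)) (cnj_vec (y F))) * hprod (y F) (x F)"
      unfolding q_def u_def v_def hprod_alt[of "y F"] sum_distrib_left
      by (intro sum.cong) (simp_all add: mult_ac)
    then show ?case
      using elim s ev(2)[of F]
      by (simp add: u_def v_def norm_smult norm_mult norm_divide norm_cnj_vec unit_eigenvectors_def)
  qed
  have inner: "cmod s * ((G *v (L h *v x E)) \<bullet> x E +
        (transpose G *v (transpose (L h) *v cnj_vec (y E))) \<bullet> cnj_vec (y E)) =
      h \<bullet> ((\<epsilon> * cmod (hprod (y E) (x E))) *\<^sub>R ReS A \<epsilon> \<mu> x y E)" for h
  proof -
    have "(transpose G *v (transpose (L h) *v cnj_vec (y E))) \<bullet> cnj_vec (y E) =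
        Re (hprod (y E) (L h *v (G *v y E)))"
    proof -
      have "hprod (cnj_vec (y E)) (transpose G *v (transpose (L h) *v cnj_vec (y E))) =
          hprod (cnj_vec (L h *v (G *v y E))) (cnj_vec (y E))"
        by (simp only: hprod_transpose)
      then show ?thesis
        by (simp add: inner_eq_Re_hprod hprod_cnj_vec)
    qed
    then have "(G *v (L h *v x E)) \<bullet> x E +
        (transpose G *v (transpose (L h) *v cnj_vec (y E))) \<bullet> cnj_vec (y E) =
        (\<epsilon> *\<^sub>R h) \<bullet> ReS A \<epsilon> \<mu> x y E"
      unfolding ReS_def S_matrix_def inner_Re_matrix_S
      by (simp add: inner_eq_Re_hprod L_def G_def M_def)
    then show ?thesis
      by (simp add: s_def)
  qed
  have "((\<lambda>F. cmod (hprod (y F) (x F))) has_derivative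
      (\<lambda>h. cmod s * ((G *v (L h *v x E)) \<bullet> x E +
        (transpose G *v (transpose (L h) *v cnj_vec (y E))) \<bullet> cnj_vec (y E)))) (at E)"
    using eq by (intro has_derivative_transform_eventually[OF quot])
      (auto simp: eventually_nhds_conv_at)
  then show ?thesis
    unfolding gderiv_def inner .
qed

section \<open>Tangent spaces of the unit sphere and of the rank-4 manifold\<close>

text \<open>
  Differentiating \<open>\<gamma> \<bullet> \<gamma> = 1\<close> shows orthogonality. Conversely, great circles realise the orthogonal
  vectors (the constant curve for \<open>v = 0\<close>).
\<close>

lemma tangent_space_R1: "tangent_space R1 E = {v. E \<bullet> v = 0}" if E: "E \<in> R1" for E :: "real^'n^'n"
proof (intro equalityI subsetI)
  fix v assume "v \<in> tangent_space R1 E"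
  then obtain \<gamma> \<delta> where g: "\<delta> > 0" "\<gamma> 0 = E" "\<forall>t\<in>{-\<delta><..<\<delta>}. \<gamma> t \<in> R1"
      "(\<gamma> has_vector_derivative v) (at 0)"
    by (auto simp: tangent_space_def)
  have "((\<lambda>t. \<gamma> t \<bullet> \<gamma> t) has_vector_derivative \<gamma> 0 \<bullet> v + v \<bullet> \<gamma> 0) (at 0)"
    by (rule bounded_bilinear.has_vector_derivative[OF bounded_bilinear_inner g(4) g(4)])
  then have d: "((\<lambda>t. \<gamma> t \<bullet> \<gamma> t) has_vector_derivative 2 * (E \<bullet> v)) (at 0)"
    by (simp add: g(2) inner_commute)
  have "((\<lambda>t. \<gamma> t \<bullet> \<gamma> t) has_vector_derivative 0) (at 0)"
  proof (rule has_vector_derivative_transform_within_open[where f="\<lambda>_. 1"])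
    show "open {-\<delta><..<\<delta>}" "0 \<in> {-\<delta><..<\<delta>}" using g(1) by auto
    show "1 = \<gamma> t \<bullet> \<gamma> t" if "t \<in> {-\<delta><..<\<delta>}" for t
      using g(3) that by (simp add: R1_def dot_square_norm)
  qed (rule has_vector_derivative_const)
  from vector_derivative_unique_at[OF d this] show "v \<in> {v. E \<bullet> v = 0}" by simp
next
  fix v assume "v \<in> {v. E \<bullet> v = 0}"
  then have v: "E \<bullet> v = 0" by simp
  have EE: "E \<bullet> E = 1" using E by (simp add: R1_def dot_square_norm)
  define N where "N = norm v"
  define w where "w = sgn v"
  have vw: "v = N *\<^sub>R w" by (cases "v = 0") (simp_all add: N_def w_def sgn_div_norm)
  have Ew: "E \<bullet> w = 0" using v by (simp add: w_def sgn_div_norm)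
  define \<gamma> where "\<gamma> t = cos (N * t) *\<^sub>R E + sin (N * t) *\<^sub>R w" for t
  have "\<gamma> t \<in> R1" for t
  proof -
    have "\<gamma> t \<bullet> \<gamma> t = (cos (N * t))\<^sup>2 + (sin (N * t))\<^sup>2 * (w \<bullet> w)"
      by (simp add: \<gamma>_def inner_add_left inner_add_right EE Ew inner_commute[of w E] power2_eq_square)
    also have "\<dots> = 1"
      by (cases "v = 0") (simp_all add: w_def N_def dot_square_norm norm_sgn)
    finally show ?thesis by (simp add: R1_def norm_eq_1)
  qed
  moreover have "\<gamma> 0 = E" by (simp add: \<gamma>_def)
  moreover have "(\<gamma> has_vector_derivative v) (at 0)"
    unfolding \<gamma>_def vw
    by (auto intro!: derivative_eq_intros has_vector_derivative_scaleR)
  ultimately show "v \<in> tangent_space R1 E"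
    unfolding tangent_space_def by (auto intro!: exI[of _ \<gamma>] exI[of _ 1])
qed

lemma matrix_scaleR_left: "(c *\<^sub>R A) ** B = c *\<^sub>R (A ** B)" for A :: "real^'n^'m"
  by (simp add: matrix_matrix_mult_def vec_eq_iff sum_distrib_left mult_ac)

lemma matrix_scaleR_right: "A ** (c *\<^sub>R B) = c *\<^sub>R (A ** B)" for A :: "real^'n^'m"
  by (simp add: matrix_matrix_mult_def vec_eq_iff sum_distrib_left mult_ac)

lemma rank_mult_invertible:
  fixes E :: "real^'n^'n"
  assumes "invertible X" "invertible Y"
  shows "rank (X ** E ** Y) = rank E"
proof (rule antisym)
  show "rank (X ** E ** Y) \<le> rank E"
    by (meson order_trans rank_mul_le_left rank_mul_le_right)
  obtain X' Y' where X': "X' ** X = mat 1" and Y': "Y ** Y' = mat 1"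
    using assms by (auto simp: invertible_def)
  have "E = X' ** (X ** E ** Y) ** Y'"
    by (metis X' Y' matrix_mul_assoc matrix_mul_lid matrix_mul_rid)
  then show "rank E \<le> rank (X ** E ** Y)"
    by (metis order_trans rank_mul_le_left rank_mul_le_right)
qed

lemma invertible_near_identity:
  fixes X :: "real^'n^'n"
  shows "\<forall>\<^sub>F t in nhds 0. invertible (mat 1 + t *\<^sub>R X)"
proof -
  have "continuous_on UNIV (\<lambda>t. det (mat 1 + t *\<^sub>R X))"
    unfolding det_def by (intro continuous_intros)
  then have "open {t. det (mat 1 + t *\<^sub>R X) \<noteq> 0}"
    by (intro open_Collect_neq continuous_intros)
  then have "\<forall>\<^sub>F t in nhds 0. t \<in> {t. det (mat 1 + t *\<^sub>R X) \<noteq> 0}"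
    by (rule eventually_nhds_in_open) simp
  then show ?thesis
    by (simp add: invertible_det_nz)
qed

lemma M4_proj_eq:
  "M4_proj U V Z = U ** transpose U ** Z + (Z - U ** transpose U ** Z) ** (V ** transpose V)"
  by (simp add: M4_proj_def matrix_diff_ldistrib matrix_diff_rdistrib matrix_mul_assoc)

text \<open>
  With the pseudoinverse \<open>P\<close> of \<open>E\<close>, the projected matrix is \<open>X E + E Y\<close>, where
  \<open>X = (Z - U U\<^sup>T Z) P\<close> and \<open>Y = P Z\<close>. This is the velocity of the curve \<open>(I + t X) E (I + t Y)\<close>, which
  has constant rank while its outer factors are invertible.
\<close>

lemma M4_proj_in_tangent_space:
  fixes E :: "real^'n^'n"
  assumes E: "E \<in> M4" and f: "M4_factors E U V"
  shows "M4_proj U V Z \<in> tangent_space M4 E"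
proof -
  obtain T where UU: "transpose U ** U = mat 1" and VV: "transpose V ** V = mat 1"
    and T: "invertible T" "E = U ** T ** transpose V"
    using f by (auto simp: M4_factors_def)
  obtain T' where T': "T ** T' = mat 1" "T' ** T = mat 1"
    using T(1) by (auto simp: invertible_def)
  define P where "P = V ** T' ** transpose U"
  have EP: "E ** P = U ** transpose U"
  proof -
    have "E ** P = U ** (T ** (transpose V ** V) ** T') ** transpose U"
      by (simp add: T(2) P_def matrix_mul_assoc)
    then show ?thesis by (simp add: VV T')
  qed
  have PE: "P ** E = V ** transpose V"
  proof -
    have "P ** E = V ** (T' ** (transpose U ** U) ** T) ** transpose V"
      by (simp add: T(2) P_def matrix_mul_assoc)
    then show ?thesis by (simp add: UU T')
  qed
  define X where "X = (Z - U ** transpose U ** Z) ** P"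
  define Y where "Y = P ** Z"
  define v where "v = M4_proj U V Z"
  have v: "v = X ** E + E ** Y"
    by (simp add: v_def M4_proj_eq X_def Y_def matrix_mul_assoc EP)
       (simp add: PE flip: matrix_mul_assoc)
  define \<gamma> where "\<gamma> t = (mat 1 + t *\<^sub>R X) ** E ** (mat 1 + t *\<^sub>R Y)" for t :: real
  have \<gamma>: "\<gamma> t = E + t *\<^sub>R v + (t * t) *\<^sub>R (X ** E ** Y)" for t
    unfolding \<gamma>_def v
    by (simp add: matrix_add_ldistrib matrix_add_rdistrib matrix_scaleR_left matrix_scaleR_right
        algebra_simps)
  have "\<forall>\<^sub>F t in nhds 0. \<gamma> t \<in> M4"
    using invertible_near_identity[of X] invertible_near_identity[of Y]
  proof eventually_elim
    case (elim t)
    then show ?case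
      using E rank_mult_invertible[OF elim] by (simp add: M4_def \<gamma>_def)
  qed
  then obtain \<delta> where d: "\<delta> > 0" "\<And>t. dist t 0 < \<delta> \<Longrightarrow> \<gamma> t \<in> M4"
    by (auto simp: eventually_nhds_metric)
  have "(\<gamma> has_vector_derivative v) (at 0)"
    unfolding \<gamma> by (auto intro!: derivative_eq_intros)
  moreover have "\<gamma> 0 = E" by (simp add: \<gamma>)
  ultimately show ?thesis
    unfolding tangent_space_def v_def[symmetric] using d
    by (auto intro!: exI[of _ \<gamma>] exI[of _ \<delta>])
qed

text \<open>
  A function bounded by a multiple of the product of the norms of two differentiable functions that both vanish at \<open>0\<close> is of second
  order there.
\<close>

lemma derivative_zero_if_quadratic:
  fixes f :: "real \<Rightarrow> real" and p :: "real \<Rightarrow> 'a::real_normed_vector" and q :: "real \<Rightarrow> 'b::real_normed_vector"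
  assumes f: "(f has_vector_derivative f') (at 0)"
    and p: "(p has_vector_derivative p') (at 0)" "p 0 = 0"
    and q: "(q has_vector_derivative q') (at 0)" "q 0 = 0"
    and bound: "\<forall>\<^sub>F t in nhds 0. \<bar>f t\<bar> \<le> C * (norm (p t) * norm (q t))"
  shows "f' = 0"
proof -
  have f0: "f 0 = 0"
    using eventually_nhds_x_imp_x[OF bound] by (simp add: p(2))
  have quot: "((\<lambda>t. (1 / t) *\<^sub>R r t) \<longlongrightarrow> r') (at 0)"
    if "(r has_vector_derivative r') (at 0)" "r 0 = 0" for r :: "real \<Rightarrow> 'c::real_normed_vector" and r'
  proof (rule LIM_zero_cancel, rule tendsto_norm_zero_cancel)
    have "((\<lambda>t. norm (r t - t *\<^sub>R r') / norm t) \<longlongrightarrow> 0) (at 0)"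
      using that by (simp add: has_vector_derivative_def has_derivative_iff_norm)
    moreover have eq: "norm (r t - t *\<^sub>R r') / norm t = norm ((1 / t) *\<^sub>R r t - r')" if "t \<noteq> 0" for t
    proof -
      have "(1 / t) *\<^sub>R r t - r' = (1 / t) *\<^sub>R (r t - t *\<^sub>R r')"
        using that by (simp add: scaleR_diff_right)
      then show ?thesis by (simp add: divide_inverse_commute)
    qed
    ultimately show "((\<lambda>t. norm ((1 / t) *\<^sub>R r t - r')) \<longlongrightarrow> 0) (at 0)"
      by (elim Lim_transform_eventually) (use eq in \<open>auto simp: eventually_at_filter\<close>)
  qed
  have "((\<lambda>t. C * (norm ((1 / t) *\<^sub>R p t) * norm (q t))) \<longlongrightarrow> C * (norm p' * norm (q 0))) (at 0)"
    using quot[OF p] has_vector_derivative_continuous[OF q(1)]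
    by (intro tendsto_intros) (simp_all add: isCont_def)
  then have lim: "((\<lambda>t. C * (norm ((1 / t) *\<^sub>R p t) * norm (q t))) \<longlongrightarrow> 0) (at 0)"
    by (simp add: q(2))
  have "\<forall>\<^sub>F t in at 0. norm ((1 / t) *\<^sub>R f t) \<le> C * (norm ((1 / t) *\<^sub>R p t) * norm (q t))"
  proof (rule eventually_mono)
    show "\<forall>\<^sub>F t in at 0. \<bar>f t\<bar> \<le> C * (norm (p t) * norm (q t))"
      using bound by (simp add: eventually_nhds_conv_at)
    fix t :: real assume "\<bar>f t\<bar> \<le> C * (norm (p t) * norm (q t))"
    from mult_left_mono[OF this, of "\<bar>1 / t\<bar>"]
    show "norm ((1 / t) *\<^sub>R f t) \<le> C * (norm ((1 / t) *\<^sub>R p t) * norm (q t))"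
      by (simp add: mult_ac)
  qed
  from Lim_null_comparison[OF this lim]
  show ?thesis
    using quot[OF f f0] tendsto_unique by (metis trivial_limit_at)
qed

text \<open>
  It has to be shown that a velocity \<open>v\<close> of a rank-4 curve satisfies
  \<open>(I - U U\<^sup>T) v (I - V V\<^sup>T) = 0\<close>. Near \<open>0\<close> the four columns of \<open>\<gamma> K\<close>, with \<open>K = V T\<^sup>-\<^sup>1\<close>, are independent,
  because \<open>U\<^sup>T \<gamma> K\<close> is close to the identity; as the rank is four, they span the range of \<open>\<gamma>\<close>. So
  \<open>\<gamma> w = \<gamma> K c\<close> with \<open>c\<close> bounded by \<open>U\<^sup>T \<gamma> w\<close>. For \<open>w\<close> in the range of \<open>I - V V\<^sup>T\<close>, both \<open>c\<close> and
  \<open>(I - U U\<^sup>T) \<gamma> K\<close> are of first order in \<open>t\<close>, so \<open>(I - U U\<^sup>T) \<gamma> w\<close> is of second order.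
\<close>

lemma tangent_space_M4_subset:
  fixes E :: "real^'n^'n"
  assumes f: "M4_factors E U V" and v: "v \<in> tangent_space M4 E"
  shows "M4_proj U V v = v"
proof -
  obtain T where UU: "transpose U ** U = mat 1" and VV: "transpose V ** V = mat 1"
    and T: "invertible T" "E = U ** T ** transpose V"
    using f by (auto simp: M4_factors_def)
  obtain T' where T': "T ** T' = mat 1" "T' ** T = mat 1"
    using T(1) by (auto simp: invertible_def)
  obtain \<gamma> \<delta> where g: "\<delta> > 0" "\<gamma> 0 = E" "\<forall>t\<in>{-\<delta><..<\<delta>}. \<gamma> t \<in> M4"
      "(\<gamma> has_vector_derivative v) (at 0)"
    using v by (auto simp: tangent_space_def)
  interpret mv: bounded_bilinear "(*v) :: real^4^4 \<Rightarrow> real^4 \<Rightarrow> real^4"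
    by (rule bounded_bilinear_matrix_vector_mult)
  obtain b where b: "b > 0" "\<And>(K :: real^4^4) c. norm (K *v c) \<le> norm K * norm c * b"
    using mv.pos_bounded by blast
  define K where "K = V ** T'"
  define D where "D t = transpose U ** \<gamma> t ** K" for t
  have D0: "D 0 = mat 1"
  proof -
    have "D 0 = (transpose U ** U) ** (T ** (transpose V ** V) ** T')"
      by (simp add: D_def g(2) T(2) K_def matrix_mul_assoc)
    then show ?thesis by (simp add: UU VV T')
  qed
  have \<gamma>_cont: "(\<gamma> \<longlongrightarrow> E) (nhds 0)"
    using has_vector_derivative_continuous[OF g(4)] g(2)
    by (simp add: continuous_within tendsto_nhds_iff)
  have "bounded_linear (\<lambda>Z. transpose U ** Z ** K)"
    by (intro linear_conv_bounded_linear[THEN iffD1])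
      (simp add: linear_iff matrix_add_ldistrib matrix_add_rdistrib matrix_scaleR_left
        matrix_scaleR_right)
  then have "(D \<longlongrightarrow> D 0) (nhds 0)"
    unfolding D_def using \<gamma>_cont g(2) bounded_linear.tendsto by blast
  then have "((\<lambda>t. norm (D t - mat 1) * b) \<longlongrightarrow> norm (mat 1 - mat 1 :: real^4^4) * b) (nhds 0)"
    unfolding D0 by (intro tendsto_intros)
  then have D_near: "\<forall>\<^sub>F t in nhds 0. norm (D t - mat 1) * b < 1 / 2"
    by (rule order_tendstoD) simp
  have inM: "\<forall>\<^sub>F t in nhds 0. \<gamma> t \<in> M4"
    using eventually_nhds_in_open[of "{-\<delta><..<\<delta>}" 0] g(1,3) by (auto elim: eventually_mono)
  have range: "\<forall>\<^sub>F t in nhds 0. \<forall>w. \<exists>c. \<gamma> t *v w = \<gamma> t *v (K *v c) \<and>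
      norm c \<le> 2 * norm (transpose U *v (\<gamma> t *v w))"
    using D_near inM
  proof eventually_elim
    case (elim t)
    have Dc: "D t *v c = transpose U *v (\<gamma> t *v (K *v c))" for c
      by (simp add: D_def matrix_vector_mul_assoc matrix_mul_assoc)
    have low: "norm c \<le> 2 * norm (D t *v c)" for c
    proof -
      have "norm c \<le> norm (D t *v c) + norm ((D t - mat 1) *v c)"
        using norm_triangle_ineq4[of "D t *v c" "(D t - mat 1) *v c"]
        by (simp add: matrix_vector_mult_diff_rdistrib)
      also have "norm ((D t - mat 1) *v c) \<le> norm (D t - mat 1) * b * norm c"
        using b(2)[of "D t - mat 1" c] by (simp add: mult_ac)
      also have "\<dots> \<le> 1 / 2 * norm c"
        using elim(1) by (intro mult_right_mono) auto
      finally show ?thesis by simp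
    qed
    have "inj ((*v) (\<gamma> t ** K))"
    proof (rule injI)
      fix c c' assume "(\<gamma> t ** K) *v c = (\<gamma> t ** K) *v c'"
      then have "D t *v (c - c') = 0"
        by (simp add: Dc matrix_vector_mult_diff_distrib matrix_vector_mul_assoc)
      then show "c = c'" using low[of "c - c'"] by simp
    qed
    then have "rank (\<gamma> t ** K) = CARD(4)"
      by (rule full_rank_injective[THEN iffD2])
    then have "dim (range ((*v) (\<gamma> t))) \<le> dim (range ((*v) (\<gamma> t ** K)))"
      using elim(2) by (simp add: M4_def flip: rank_dim_range)
    moreover have "range ((*v) (\<gamma> t ** K)) \<subseteq> range ((*v) (\<gamma> t))"
      by (auto simp flip: matrix_vector_mul_assoc)
    ultimately have eq: "range ((*v) (\<gamma> t ** K)) = range ((*v) (\<gamma> t))"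
      by (intro subspace_dim_equal) (auto intro: linear_subspace_image matrix_vector_mul_linear)
    show ?case
    proof
      fix w
      have "\<gamma> t *v w \<in> range ((*v) (\<gamma> t ** K))"
        unfolding eq by simp
      then obtain c where c: "\<gamma> t *v w = \<gamma> t *v (K *v c)"
        by (auto simp flip: matrix_vector_mul_assoc)
      then show "\<exists>c. \<gamma> t *v w = \<gamma> t *v (K *v c) \<and> norm c \<le> 2 * norm (transpose U *v (\<gamma> t *v w))"
        using low[of c] by (auto simp: Dc)
    qed
  qed
  define QU where "QU = mat 1 - U ** transpose U"
  define QV where "QV = mat 1 - V ** transpose V"
  have QUE: "QU ** E = 0" 
  proof -
    have "U ** transpose U ** E = U ** (transpose U ** U) ** T ** transpose V"
      by (simp add: T(2) matrix_mul_assoc)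
    then show ?thesis by (simp add: QU_def matrix_diff_rdistrib UU T(2))
  qed
  have EQV: "E ** QV = 0"
  proof -
    have "E ** (V ** transpose V) = U ** T ** (transpose V ** V) ** transpose V"
      by (simp add: T(2) matrix_mul_assoc)
    then show ?thesis by (simp add: QV_def matrix_diff_ldistrib VV T(2))
  qed
  have "z \<bullet> ((QU ** v ** QV) *v w) = 0" for z w
  proof -
    define f where "f Z = z \<bullet> ((QU ** Z ** QV) *v w)" for Z
    define p where "p Z = transpose (QU ** Z ** K) *v z" for Z
    define q where "q Z = transpose U *v (Z *v (QV *v w))" for Z
    have tr: "transpose (B + C) = transpose B + transpose C"
      "transpose (r *\<^sub>R B) = r *\<^sub>R transpose B" for B C :: "real^4^'n" and r
      by (simp_all add: transpose_def vec_eq_iff)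
    have tr0: "transpose 0 = (0 :: real^'n^4)"
      by (simp add: transpose_def vec_eq_iff)
    have lin: "linear f" "linear p" "linear q"
      by (simp_all add: f_def p_def q_def linear_iff matrix_add_ldistrib matrix_add_rdistrib
          matrix_scaleR_left matrix_scaleR_right matrix_vector_mult_add_rdistrib inner_add_right
          matrix_vector_right_distrib matrix_vector_mult_scaleR tr
          flip: scaleR_matrix_vector_assoc del: transpose_matrix_vector)
    note bl = lin[THEN linear_conv_bounded_linear[THEN iffD1]]
    note d = bl[THEN bounded_linear.has_vector_derivative, OF g(4)]
    have "f v = 0"
    proof (rule derivative_zero_if_quadratic[OF d(1) d(2) _ d(3)])
      show "p (\<gamma> 0) = 0" "q (\<gamma> 0) = 0"
        by (simp_all add: g(2) p_def q_def QUE tr0 matrix_vector_mul_assoc[of E] EQV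
            del: transpose_matrix_vector)
      show "\<forall>\<^sub>F t in nhds 0. \<bar>f (\<gamma> t)\<bar> \<le> 2 * (norm (p (\<gamma> t)) * norm (q (\<gamma> t)))"
        using range
      proof eventually_elim
        case (elim t)
        obtain c where c: "\<gamma> t *v (QV *v w) = \<gamma> t *v (K *v c)" "norm c \<le> 2 * norm (q (\<gamma> t))"
          using elim unfolding q_def by blast
        have "f (\<gamma> t) = z \<bullet> ((QU ** \<gamma> t ** K) *v c)"
          using c(1) by (simp add: f_def flip: matrix_vector_mul_assoc)
        also have "\<dots> = p (\<gamma> t) \<bullet> c"
          unfolding p_def by (metis dot_lmul_matrix transpose_matrix_vector)
        finally have "\<bar>f (\<gamma> t)\<bar> \<le> norm (p (\<gamma> t)) * norm c"
          by (simp add: Cauchy_Schwarz_ineq2)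
        also have "\<dots> \<le> norm (p (\<gamma> t)) * (2 * norm (q (\<gamma> t)))"
          using c(2) by (intro mult_left_mono) auto
        finally show ?case by simp
      qed
    qed
    then show ?thesis by (simp add: f_def)
  qed
  then have "QU ** v ** QV = 0"
    by (metis inner_eq_zero_iff matrix_eq matrix_vector_mult_0)
  then show ?thesis
    by (simp add: M4_proj_def QU_def QV_def)
qed

section \<open>The projected gradient flow\<close>

lemma transpose_complement_projector:
  "transpose (mat 1 - U ** transpose U) = mat 1 - U ** transpose (U :: real^'m^'n)"
  by (simp add: transpose_diff matrix_transpose_mul)

lemma M4_proj_add_scaled:
  "M4_proj U V (a *\<^sub>R Z + b *\<^sub>R Z') = a *\<^sub>R M4_proj U V Z + b *\<^sub>R M4_proj U V Z'"
  by (simp add: M4_proj_def matrix_add_ldistrib matrix_add_rdistrib matrix_scaleR_left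
      matrix_scaleR_right algebra_simps)

text \<open>
  The residual is \<open>(I - U U\<^sup>T) Z (I - V V\<^sup>T)\<close>. Both outer factors are symmetric and can be moved over
  to \<open>w\<close>, where they give \<open>w - M4_proj U V w = 0\<close>.
\<close>

lemma M4_proj_residual_orthogonal:
  fixes Z w :: "real^'n^'n"
  assumes "M4_proj U V w = w"
  shows "(Z - M4_proj U V Z) \<bullet> w = 0"
proof -
  let ?Q = "mat 1 - U ** transpose U" and ?R = "mat 1 - V ** transpose V"
  have w: "?Q ** w ** ?R = 0"
    using assms by (simp add: M4_proj_def)
  have "(Z - M4_proj U V Z) \<bullet> w = trace (transpose (?Q ** Z ** ?R) ** w)"
    by (simp add: M4_proj_def inner_eq_trace_transpose_mult)
  also have "\<dots> = trace (?R ** (transpose Z ** ?Q ** w))"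
    by (simp add: matrix_transpose_mul transpose_complement_projector matrix_mul_assoc)
  also have "\<dots> = trace (transpose Z ** (?Q ** w ** ?R))"
    by (subst trace_mul_sym) (simp only: matrix_mul_assoc)
  finally show ?thesis by (simp add: w trace_def)
qed

lemma M4_proj_base:
  assumes "M4_factors E U V"
  shows "M4_proj U V E = E"
proof -
  obtain T where UU: "transpose U ** U = mat 1" and T: "E = U ** T ** transpose V"
    using assms by (auto simp: M4_factors_def)
  have "U ** transpose U ** E = U ** (transpose U ** U) ** T ** transpose V"
    by (simp add: T matrix_mul_assoc)
  then have "U ** transpose U ** E = E"
    by (simp add: UU T)
  then show ?thesis
    by (simp add: M4_proj_eq)
qed

text \<open>
  Every \<open>E\<close> of rank 4 is tangent to the rank-4 manifold at itself (scaling \<open>E\<close> preserves the rank), so the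
  orthogonal projections onto the tangent space of that manifold and onto the complement of \<open>E\<close> commute. Their
  composition projects onto the intersection.
\<close>

lemma orth_proj_R1_M4:
  fixes E Z :: "real^'n^'n"
  assumes E: "E \<in> R1 \<inter> M4" and f: "M4_factors E U V"
  defines "q \<equiv> M4_proj U V Z - (E \<bullet> Z) *\<^sub>R E"
  shows "is_orth_proj (tangent_space R1 E \<inter> tangent_space M4 E) Z q"
    and "Z \<bullet> q = (norm q)\<^sup>2"
proof -
  have fixE: "M4_proj U V E = E"
    using f by (rule M4_proj_base)
  have idem: "M4_proj U V (M4_proj U V Z) = M4_proj U V Z"
    using tangent_space_M4_subset[OF f M4_proj_in_tangent_space[OF _ f]] E by simp
  have fixq: "M4_proj U V q = q"
    using M4_proj_add_scaled[of U V 1 "M4_proj U V Z" "- (E \<bullet> Z)" E]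
    by (simp add: q_def idem fixE)
  have EE: "E \<bullet> E = 1"
    using E by (simp add: R1_def dot_square_norm)
  have "E \<bullet> q = 0"
    using M4_proj_residual_orthogonal[OF fixE, of Z]
    by (simp add: q_def inner_diff_left inner_diff_right EE inner_commute)
  moreover have "q \<in> tangent_space M4 E"
    using M4_proj_in_tangent_space[OF _ f, of q] E by (simp add: fixq)
  ultimately have mem: "q \<in> tangent_space R1 E \<inter> tangent_space M4 E"
    using E by (simp add: tangent_space_R1)
  moreover have orth: "(Z - q) \<bullet> w = 0" if "w \<in> tangent_space R1 E \<inter> tangent_space M4 E" for w
  proof -
    have "E \<bullet> w = 0" "M4_proj U V w = w"
      using that E tangent_space_M4_subset[OF f] by (auto simp: tangent_space_R1)
    then show ?thesis
      using M4_proj_residual_orthogonal[of U V w Z]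
      by (simp add: q_def inner_diff_left inner_add_left)
  qed
  ultimately show "is_orth_proj (tangent_space R1 E \<inter> tangent_space M4 E) Z q"
    by (simp add: is_orth_proj_def)
  show "Z \<bullet> q = (norm q)\<^sup>2"
    using orth[OF mem] by (simp add: inner_diff_left dot_square_norm)
qed

lemma gradient_local_extension:
  fixes A :: "real^'n^'n"
  assumes "local_extension A \<epsilon> \<mu> x y E W \<mu>' x' y'" and E: "E \<in> R1"
  shows "GDERIV (\<lambda>F. cmod (hprod (y' F) (x' F))) E :>
    (\<epsilon> * cmod (hprod (y E) (x E))) *\<^sub>R ReS A \<epsilon> \<mu> x y E"
proof -
  have W: "open W" "E \<in> W" "continuous_on W \<mu>'" "eigendata_on W A \<epsilon> \<mu>' x' y'"
    and eq: "\<mu>' E = \<mu> E" "x' E = x E" "y' E = y E"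
    using assms by (auto simp: local_extension_def)
  show ?thesis
    using gradient_eigenvector_product[OF W] by (simp add: ReS_def eq)
qed

text \<open>
  The curve stays on the sphere, where the local extension agrees with the given eigenvectors, so the
  chain rule for the extension applies to them.
\<close>

lemma derivative_along_curve:
  fixes A :: "real^'n^'n" and E :: "real \<Rightarrow> real^'n^'n"
  assumes ext: "local_extension A \<epsilon> \<mu> x y (E t) W \<mu>' x' y'"
    and R1: "\<And>s. s \<in> J \<Longrightarrow> E s \<in> R1" and t: "t \<in> J"
    and E: "(E has_vector_derivative v) (at t within J)"
  shows "((\<lambda>s. cmod (hprod (y (E s)) (x (E s)))) has_real_derivative
    \<epsilon> * cmod (hprod (y (E t)) (x (E t))) * (v \<bullet> ReS A \<epsilon> \<mu> x y (E t))) (at t within J)"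
proof -
  have W: "open W" "E t \<in> W"
    and eq: "\<And>F. F \<in> W \<inter> R1 \<Longrightarrow> x' F = x F \<and> y' F = y F"
    using ext by (auto simp: local_extension_def)
  note grad = gradient_local_extension[OF ext R1[OF t]]
  have "((\<lambda>s. cmod (hprod (y' (E s)) (x' (E s)))) has_derivative
      (\<lambda>h. (h *\<^sub>R v) \<bullet> ((\<epsilon> * cmod (hprod (y (E t)) (x (E t)))) *\<^sub>R ReS A \<epsilon> \<mu> x y (E t)))) (at t within J)"
    by (rule has_derivative_compose[OF E[unfolded has_vector_derivative_def] grad[unfolded gderiv_def]])
  moreover have "\<forall>\<^sub>F s in at t within J. cmod (hprod (y' (E s)) (x' (E s))) = cmod (hprod (y (E s)) (x (E s)))"
  proof -
    have "\<forall>\<^sub>F s in at t within J. E s \<in> W"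
      using has_vector_derivative_continuous[OF E] W
      by (simp add: continuous_within topological_tendstoD)
    moreover have "\<forall>\<^sub>F s in at t within J. s \<in> J"
      by (simp add: eventually_at_filter)
    ultimately show ?thesis
      by eventually_elim (simp add: eq R1)
  qed
  ultimately have "((\<lambda>s. cmod (hprod (y (E s)) (x (E s)))) has_derivative
      (\<lambda>h. (h *\<^sub>R v) \<bullet> ((\<epsilon> * cmod (hprod (y (E t)) (x (E t)))) *\<^sub>R ReS A \<epsilon> \<mu> x y (E t)))) (at t within J)"
    by (rule has_derivative_transform_eventually) (use eq W(2) R1 t in auto)
  then show ?thesis
    unfolding has_field_derivative_def
    by (rule has_derivative_eq_rhs) (auto simp: algebra_simps)
qed

theorem theorem6p3:
  fixes A :: "real^'n^'n"
    and lam0 :: complex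
    and \<epsilon>0 \<epsilon> :: real
    and lam :: "real \<Rightarrow> real^'n^'n \<Rightarrow> complex"
    and x y :: "real^'n^'n \<Rightarrow> complex^'n"
    and U V :: "real^'n^'n \<Rightarrow> real^4^'n"
  assumes "simple_eigenvalue (complexify A) lam0"
    and "\<epsilon>0 > 0"
    and "eigenvalue_continuation A lam0 \<epsilon>0 lam"
    and "0 < \<epsilon>" and "\<epsilon> \<le> \<epsilon>0"
    and "\<forall>E\<in>R1. unit_eigenvectors (complexify (A + \<epsilon> *\<^sub>R E)) (lam \<epsilon> E) (x E) (y E)"
    and "\<forall>E\<in>R1 \<inter> M4. M4_factors E (U E) (V E)"
  shows "(\<forall>E\<in>R1 \<inter> M4.
           (\<exists>W \<mu>' x' y'. local_extension A \<epsilon> (lam \<epsilon>) x y E W \<mu>' x' y') \<and>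
           (\<forall>W \<mu>' x' y'. local_extension A \<epsilon> (lam \<epsilon>) x y E W \<mu>' x' y' \<longrightarrow>
              (\<exists>g p. GDERIV (\<lambda>F. cmod (hprod (y' F) (x' F))) E :> g \<and>
                 is_orth_proj (tangent_space R1 E \<inter> tangent_space M4 E) g p \<and>
                 (\<exists>c>0. flow_rhs A \<epsilon> (lam \<epsilon>) x y U V E = - (c *\<^sub>R p)))))
       \<and> (\<forall>(J :: real set) (E :: real \<Rightarrow> real^'n^'n).
           is_interval J \<and>
           (\<forall>t\<in>J. E t \<in> R1 \<inter> M4 \<and>
              (E has_vector_derivative flow_rhs A \<epsilon> (lam \<epsilon>) x y U V (E t)) (at t within J)) \<longrightarrow>
           (\<forall>t\<in>J.
              ((\<lambda>s. cmod (hprod (y (E s)) (x (E s)))) has_real_derivative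
                 - \<epsilon> * cmod (hprod (y (E t)) (x (E t))) *
                   (norm (M4_proj (U (E t)) (V (E t)) (ReS A \<epsilon> (lam \<epsilon>) x y (E t))
                      - (E t \<bullet> ReS A \<epsilon> (lam \<epsilon>) x y (E t)) *\<^sub>R E t))\<^sup>2)
              (at t within J)))"
proof -
  define Z where "Z E = ReS A \<epsilon> (lam \<epsilon>) x y E" for E
  define q where "q E = M4_proj (U E) (V E) (Z E) - (E \<bullet> Z E) *\<^sub>R E" for E
  define k where "k E = \<epsilon> * cmod (hprod (y E) (x E))" for E
  have flow: "flow_rhs A \<epsilon> (lam \<epsilon>) x y U V E = - q E" for E
    by (simp add: flow_rhs_def q_def Z_def)
  have \<epsilon>: "\<epsilon> \<in> {0..\<epsilon>0}"
    using assms(4,5) by simp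
  have "continuous_on ({0..\<epsilon>0} \<times> R1) (\<lambda>(\<epsilon>, E). lam \<epsilon> E)"
    using assms(3) by (simp add: eigenvalue_continuation_def)
  from continuous_on_compose2[OF this, of R1 "\<lambda>E. (\<epsilon>, E)"] \<epsilon>
  have "continuous_on R1 (\<lambda>E. case (\<epsilon>, E) of (\<epsilon>, E) \<Rightarrow> lam \<epsilon> E)"
    by (simp add: continuous_on_Pair continuous_on_id image_subset_iff)
  then have cont: "continuous_on R1 (lam \<epsilon>)" by simp
  have data: "eigendata_on R1 A \<epsilon> (lam \<epsilon>) x y"
    using assms(3,6) \<epsilon> by (simp add: eigendata_on_def eigenvalue_continuation_def)
  note ext = local_extension_exists[OF cont data]
  have k: "k E > 0" if "E \<in> R1" for E
    using data that assms(4) eigenvectors_nonorthogonal_and_group_inverse(1)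
    by (force simp: k_def eigendata_on_def)
  have part1: "\<exists>g p. GDERIV (\<lambda>F. cmod (hprod (y' F) (x' F))) E :> g \<and>
      is_orth_proj (tangent_space R1 E \<inter> tangent_space M4 E) g p \<and>
      (\<exists>c>0. flow_rhs A \<epsilon> (lam \<epsilon>) x y U V E = - (c *\<^sub>R p))"
    if E: "E \<in> R1 \<inter> M4" and le: "local_extension A \<epsilon> (lam \<epsilon>) x y E W \<mu>' x' y'" for E W \<mu>' x' y'
  proof (intro exI conjI)
    show "GDERIV (\<lambda>F. cmod (hprod (y' F) (x' F))) E :> k E *\<^sub>R Z E"
      using gradient_local_extension[OF le] E by (simp add: k_def Z_def)
    have "M4_proj (U E) (V E) (k E *\<^sub>R Z E) - (E \<bullet> k E *\<^sub>R Z E) *\<^sub>R E = k E *\<^sub>R q E"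
      using M4_proj_add_scaled[of "U E" "V E" "k E" "Z E" 0 0]
      by (simp add: q_def scaleR_diff_right)
    then show "is_orth_proj (tangent_space R1 E \<inter> tangent_space M4 E) (k E *\<^sub>R Z E) (k E *\<^sub>R q E)"
      using orth_proj_R1_M4(1)[OF E, of "U E" "V E" "k E *\<^sub>R Z E"] assms(7) E by simp
    show "1 / k E > 0" "flow_rhs A \<epsilon> (lam \<epsilon>) x y U V E = - ((1 / k E) *\<^sub>R k E *\<^sub>R q E)"
      using k[of E] E by (auto simp: flow)
  qed
  have part2: "((\<lambda>s. cmod (hprod (y (E s)) (x (E s)))) has_real_derivative
      - \<epsilon> * cmod (hprod (y (E t)) (x (E t))) * (norm (q (E t)))\<^sup>2) (at t within J)"
    if t: "t \<in> J" and E: "\<And>t. t \<in> J \<Longrightarrow> E t \<in> R1 \<inter> M4 \<and>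
        (E has_vector_derivative flow_rhs A \<epsilon> (lam \<epsilon>) x y U V (E t)) (at t within J)"
    for J and E :: "real \<Rightarrow> real^'n^'n" and t
  proof -
    have Et: "E t \<in> R1 \<inter> M4" "(E has_vector_derivative - q (E t)) (at t within J)"
      using E[OF t] by (simp_all add: flow)
    obtain W \<mu>' x' y' where le: "local_extension A \<epsilon> (lam \<epsilon>) x y (E t) W \<mu>' x' y'"
      using ext[of "E t"] Et(1) by blast
    have "Z (E t) \<bullet> q (E t) = (norm (q (E t)))\<^sup>2"
      unfolding q_def by (rule orth_proj_R1_M4(2)[OF Et(1)]) (use assms(7) Et(1) in blast)
    then show ?thesis
      using derivative_along_curve[OF le _ t Et(2)] E by (simp add: Z_def inner_commute)
  qed
  show ?thesis
    using ext part1 part2 unfolding q_def Z_def by blast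
qed

end
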